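(* Let $n\ge 1$, let $G$ be a compact subgroup of $GL(n)$, and let $\Pi$ be the group of affine transformations of $\mathbb{R}^n$ generated by all shifts (translations) and the elements of $G$. Let $K_0\in W_n$ be a convex body. 1. Let $x_0\in \operatorname{Int} K_0$ be a $\Pi_{K_0}$-invariant point. Then there exists a $\Pi$-invariant point of the body $p:W_n\to\mathbb{R}^n$ such that $p(K_0)=x_0$. 2. Let $x_0\in\mathbb{R}^n$ be an arbitrary $\Pi_{K_0}$-invariant point. Then there exists a $\Pi$-invariant point $p:W_n\to\mathbb{R}^n$ such that $p(K_0)=x_0$. In other words, for every convex body $K\in W_n$, the set of all $\Pi_K$-invariant points in $\mathbb{R}^n$ coincides with the set of values $p(K)$, where $p$ ranges over all $\Pi$-invariant points.
   Context: $W_n$ denotes the set of all compact convex subsets of $\mathbb{R}^n$ with non-empty interior (called convex bodies), equipped with the topology of the Hausdorff metric. $GL(n)$ is the group of invertible linear transformations of $\mathbb{R}^n$. A $\Pi$-invariant point is a continuous mapping $p:W_n\to\mathbb{R}^n$ such that $p(A(K))=A(p(K))$ for all $K\in W_n$ and all $A\in\Pi$. A $\Pi$-invariant point of the body is a $\Pi$-invariant point $p$ such that $p(K)\in K$ for all $K\in W_n$. For $K\in W_n$, $\Pi_K=\{A\in\Pi : A(K)=K\}$ is the subgroup of automorphisms of $K$ in $\Pi$. A point $x_0\in\mathbb{R}^n$ is called $\Pi_K$-invariant if $A(x_0)=x_0$ for all $A\in\Pi_K$. $\operatorname{Int} K$ is the interior of $K$. *)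

theory Defs
  imports "HOL-Analysis.Analysis" "HOL-Algebra.Bij" "HOL-Algebra.Generated_Groups"
begin

definition GL :: "(real^'n^'n) monoid" where
  "GL = \<lparr>carrier = {A. invertible A}, mult = (**), one = mat 1\<rparr>"

lemma group_GL: "group (GL :: (real^'n^'n) monoid)"
proof (rule groupI)
  show "\<one>\<^bsub>GL\<^esub> \<in> carrier (GL :: (real^'n^'n) monoid)"
    unfolding GL_def invertible_def by (auto intro: exI[of _ "mat 1"])
next
  fix A :: "real^'n^'n" assume "A \<in> carrier GL"
  then obtain B where "A ** B = mat 1" "B ** A = mat 1"
    unfolding GL_def invertible_def by auto
  then show "\<exists>B\<in>carrier GL. B \<otimes>\<^bsub>GL\<^esub> A = \<one>\<^bsub>GL\<^esub>"
    unfolding GL_def invertible_def by auto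
qed (auto simp: GL_def invertible_mult matrix_mul_assoc)

text \<open>\<open>BijGroup UNIV\<close> is the group of all bijections of the space under composition.\<close>

definition affine_group :: "(real^'n^'n) set \<Rightarrow> (real^'n \<Rightarrow> real^'n) set" where
  "affine_group G = generate (BijGroup UNIV) (range (\<lambda>v x. v + x) \<union> (*v) ` G)"

lemma affine_group_generators:
  assumes "G \<subseteq> carrier GL"
  shows "range (\<lambda>v x. v + x) \<union> (*v) ` G \<subseteq> carrier (BijGroup (UNIV :: (real^'n) set))"
proof -
  have "bij (\<lambda>x. v + x)" for v :: "real^'n"
    by (rule bij_plus)
  moreover have "bij ((*v) A)" if "A \<in> G" for A
    using that assms by (auto simp: GL_def invertible_eq_bij)
  ultimately show ?thesis
    by (auto simp: BijGroup_def Bij_def)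
qed

definition convex_bodies :: "(real^'n) set set" where
  "convex_bodies = {K. compact K \<and> convex K \<and> interior K \<noteq> {}}"

text \<open>The value 0 outside the nonempty bounded sets is a convention, as for \<open>infdist\<close>; it makes
  the distance total, nonnegative and symmetric, as the locale \<open>Metric_space\<close> requires.\<close>

definition hausdorff_dist :: "'a::metric_space set \<Rightarrow> 'a set \<Rightarrow> real" where
  "hausdorff_dist A B =
    (if A \<noteq> {} \<and> B \<noteq> {} \<and> bounded A \<and> bounded B
     then max (SUP a\<in>A. infdist a B) (SUP b\<in>B. infdist b A) else 0)"

lemma bdd_above_infdist:
  assumes "bounded A" shows "bdd_above ((\<lambda>a. infdist a B) ` A)"
proof (cases "A = {}")
  case False
  then obtain c where c: "c \<in> A" by blast
  from assms obtain e where e: "\<And>a. a \<in> A \<Longrightarrow> dist c a \<le> e"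
    using bounded_any_center[of A c] by auto
  have "infdist a B \<le> infdist c B + e" if "a \<in> A" for a
    using infdist_triangle[of a B c] e[OF that] by (simp add: dist_commute)
  then show ?thesis by (auto intro!: bdd_aboveI)
qed auto

lemma infdist_le_hausdorff_dist:
  assumes "a \<in> A" "bounded A" "B \<noteq> {}" "bounded B"
  shows "infdist a B \<le> hausdorff_dist A B"
  using assms cSUP_upper[OF assms(1) bdd_above_infdist[OF assms(2)], of B]
  by (auto simp: hausdorff_dist_def)

lemma hausdorff_dist_commute: "hausdorff_dist A B = hausdorff_dist B A"
  by (auto simp: hausdorff_dist_def max.commute)

lemma hausdorff_dist_leI:
  assumes "A \<noteq> {}" "B \<noteq> {}" "\<And>a. a \<in> A \<Longrightarrow> infdist a B \<le> e" "\<And>b. b \<in> B \<Longrightarrow> infdist b A \<le> e"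
    "0 \<le> e"
  shows "hausdorff_dist A B \<le> e"
  using assms by (auto simp: hausdorff_dist_def intro!: cSUP_least)

lemma hausdorff_dist_nonneg: "0 \<le> hausdorff_dist A B"
proof (cases "A \<noteq> {} \<and> B \<noteq> {} \<and> bounded A \<and> bounded B")
  case True
  then obtain a where "a \<in> A" by blast
  then show ?thesis
    using True infdist_le_hausdorff_dist[of a A B] infdist_nonneg[of a B] by linarith
qed (auto simp: hausdorff_dist_def)

lemma infdist_trans_hausdorff_dist:
  fixes A B C :: "'a::heine_borel set"
  assumes "a \<in> A" "bounded A" "compact B" "B \<noteq> {}" "C \<noteq> {}" "bounded C"
  shows "infdist a C \<le> hausdorff_dist A B + hausdorff_dist B C"
proof -
  obtain b where b: "b \<in> B" "infdist a B = dist a b"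
    using infdist_attains_inf[of B a] compact_imp_closed assms by metis
  have "infdist a C \<le> infdist b C + dist a b" by (rule infdist_triangle)
  moreover have "infdist b C \<le> hausdorff_dist B C" "infdist a B \<le> hausdorff_dist A B"
    using assms b(1) infdist_le_hausdorff_dist[of b B C] infdist_le_hausdorff_dist[of a A B]
    by (simp_all add: compact_imp_bounded)
  ultimately show ?thesis using b by linarith
qed

lemma Metric_space_convex_bodies:
  "Metric_space (convex_bodies :: (real^'n) set set) hausdorff_dist"
proof
  fix A B C :: "(real^'n) set"
  show "0 \<le> hausdorff_dist A B" by (rule hausdorff_dist_nonneg)
  show "hausdorff_dist A B = hausdorff_dist B A" by (rule hausdorff_dist_commute)
  assume A: "A \<in> convex_bodies" and B: "B \<in> convex_bodies"
  have body: "compact K \<and> closed K \<and> bounded K \<and> K \<noteq> {}" if "K \<in> convex_bodies"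
    for K :: "(real^'n) set"
    using that by (auto simp: convex_bodies_def compact_imp_closed compact_imp_bounded)
  show "hausdorff_dist A B = 0 \<longleftrightarrow> A = B"
  proof
    assume 0: "hausdorff_dist A B = 0"
    have "infdist a B = 0" if "a \<in> A" for a
      using infdist_le_hausdorff_dist[of a A B] infdist_nonneg[of a B] that body[OF A] body[OF B] 0
      by simp
    moreover have "infdist b A = 0" if "b \<in> B" for b
      using infdist_le_hausdorff_dist[of b B A] infdist_nonneg[of b A] that body[OF A] body[OF B] 0
        hausdorff_dist_commute[of A B]
      by simp
    ultimately show "A = B"
      using body[OF A] body[OF B] in_closed_iff_infdist_zero by blast
  next
    assume "A = B"
    then show "hausdorff_dist A B = 0"
      using body[OF A] hausdorff_dist_nonneg[of A B] hausdorff_dist_leI[of A A 0] by simp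
  qed
  assume C: "C \<in> convex_bodies"
  show "hausdorff_dist A C \<le> hausdorff_dist A B + hausdorff_dist B C"
  proof (rule hausdorff_dist_leI)
    fix a assume "a \<in> A"
    then show "infdist a C \<le> hausdorff_dist A B + hausdorff_dist B C"
      using body[OF A] body[OF B] body[OF C] by (simp add: infdist_trans_hausdorff_dist)
  next
    fix c assume "c \<in> C"
    then show "infdist c A \<le> hausdorff_dist A B + hausdorff_dist B C"
      using body[OF A] body[OF B] body[OF C] infdist_trans_hausdorff_dist[of c C B A]
        hausdorff_dist_commute[of A B] hausdorff_dist_commute[of B C] by simp
  qed (use body[OF A] body[OF C] hausdorff_dist_nonneg[of A B] hausdorff_dist_nonneg[of B C] in auto)
qed

definition hausdorff_topology :: "(real^'n) set topology" where
  "hausdorff_topology = Metric_space.mtopology convex_bodies hausdorff_dist"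

text \<open>A mapping on convex bodies is represented by a function on all sets, whose values on other
  sets are irrelevant.\<close>

definition invariant_point ::
    "(real^'n \<Rightarrow> real^'n) set \<Rightarrow> ((real^'n) set \<Rightarrow> real^'n) \<Rightarrow> bool" where
  "invariant_point \<Phi> p \<longleftrightarrow>
     continuous_map hausdorff_topology euclidean p \<and>
     (\<forall>K\<in>convex_bodies. \<forall>A\<in>\<Phi>. p (A ` K) = A (p K))"

definition invariant_point_of_body ::
    "(real^'n \<Rightarrow> real^'n) set \<Rightarrow> ((real^'n) set \<Rightarrow> real^'n) \<Rightarrow> bool" where
  "invariant_point_of_body \<Phi> p \<longleftrightarrow>
     invariant_point \<Phi> p \<and> (\<forall>K\<in>convex_bodies. p K \<in> K)"

definition body_automorphisms ::
    "(real^'n \<Rightarrow> real^'n) set \<Rightarrow> (real^'n) set \<Rightarrow> (real^'n \<Rightarrow> real^'n) set" where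
  "body_automorphisms \<Phi> K = {A \<in> \<Phi>. A ` K = K}"

definition fixed_points :: "(real^'n \<Rightarrow> real^'n) set \<Rightarrow> (real^'n) set" where
  "fixed_points \<Gamma> = {x. \<forall>A\<in>\<Gamma>. A x = x}"

end

theory Submission
  imports Defs
begin

text \<open>Everything is built from minimizers of strongly convex functions, so no Haar measure is needed.
  Such functions stay strongly convex under suprema over \<open>G\<close>, and their unique minimizers inherit
  equivariance and depend continuously on the body. Minimizing \<open>v \<mapsto> sup {|h (v - x)|\<^sup>2 | h \<in> G, x \<in> K}\<close>
  gives an equivariant center \<open>c K\<close>; put \<open>N K = K - c K\<close> and \<open>v\<^sub>0 = x\<^sub>0 - c K\<^sub>0\<close>. The point \<open>v\<^sub>0\<close> is fixed by
  the stabilizer of \<open>N K\<^sub>0\<close> in \<open>G\<close>, so by compactness there is a modulus \<open>\<omega>\<close> with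
  \<open>|h v\<^sub>0 - g v\<^sub>0|\<^sup>2 \<le> \<omega> (d (h (N K\<^sub>0), g (N K\<^sub>0)))\<close>, where \<open>d\<close> is the Hausdorff distance. Then
  \<open>F\<^sub>K v = sup {|h v - g v\<^sub>0|\<^sup>2 - \<omega> (d (h (N K), g (N K\<^sub>0))) | h, g \<in> G}\<close> satisfies \<open>F\<^bsub>gK\<^esub> (g v) = F\<^sub>K v\<close>,
  and \<open>F\<^sub>K v \<ge> |v - v\<^sub>0|\<^sup>2\<close> with \<open>F\<^sub>K v\<^sub>0 \<le> 0\<close> for \<open>K = K\<^sub>0\<close>. Hence \<open>p K = c K + argmin F\<^sub>K\<close> takes the
  value \<open>x\<^sub>0\<close> at \<open>K\<^sub>0\<close>; minimizing over \<open>N K\<close> instead of the whole space forces \<open>p K \<in> K\<close>.\<close>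

section \<open>Minimizers of strongly convex functions\<close>

definition is_minimizer :: "('a \<Rightarrow> real) \<Rightarrow> 'a set \<Rightarrow> 'a \<Rightarrow> bool" where
  "is_minimizer f S x \<longleftrightarrow> x \<in> S \<and> (\<forall>y\<in>S. f x \<le> f y)"

definition minimizer :: "('a \<Rightarrow> real) \<Rightarrow> 'a set \<Rightarrow> 'a" where
  "minimizer f S = (THE x. is_minimizer f S x)"

text \<open>Restricted to midpoints, where the parallelogram law applies directly. One
  \<open>m\<close> must serve all \<open>u\<close> and \<open>v\<close>, since it becomes the
  constant of the quadratic gap at a minimizer.\<close>

definition strongly_midconvex :: "('a::real_normed_vector \<Rightarrow> real) \<Rightarrow> bool" where
  "strongly_midconvex f \<longleftrightarrow>
     (\<exists>m>0. \<forall>u v. f (midpoint u v) \<le> (f u + f v) / 2 - m * (norm (u - v))\<^sup>2)"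

text \<open>Linear growth makes the search compact: outside the ball of radius
  \<open>f s + b\<close> the function exceeds its value at the reference point \<open>s\<close> of
  \<open>S\<close>.\<close>

lemma minimizer_exists:
  fixes f :: "'a::euclidean_space \<Rightarrow> real"
  assumes "closed S" "S \<noteq> {}" "continuous_on UNIV f" "\<And>v. norm v - b \<le> f v"
  shows "\<exists>x. is_minimizer f S x"
proof -
  obtain s where s: "s \<in> S" using assms by auto
  let ?T = "S \<inter> cball 0 (f s + b)"
  have "compact ?T"
    using assms(1) by (simp add: closed_Int_compact)
  moreover have "s \<in> ?T" using s assms(4)[of s] by auto
  moreover have "continuous_on ?T f" using assms(3) continuous_on_subset by blast
  ultimately obtain x where x: "x \<in> ?T" "\<And>y. y \<in> ?T \<Longrightarrow> f x \<le> f y"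
    using continuous_attains_inf[of ?T f] by blast
  have "f x \<le> f y" if "y \<in> S" for y
  proof (cases "y \<in> ?T")
    case False
    then have "norm y > f s + b" using that by auto
    then show ?thesis using x(2)[OF \<open>s \<in> ?T\<close>] assms(4)[of y] by linarith
  qed (use x in blast)
  then show ?thesis using x(1) unfolding is_minimizer_def by blast
qed

text \<open>The midpoint of \<open>x\<close> and a competitor \<open>y\<close> is again in
  \<open>S\<close>, so its value is at least \<open>f x\<close>; strong midconvexity then bounds
  \<open>f y - f x\<close> from below, with twice the original constant.\<close>

lemma minimizer_gap:
  assumes "strongly_midconvex f" "convex S" "is_minimizer f S x"
  obtains m where "m > 0" "\<And>y. y \<in> S \<Longrightarrow> m * (norm (x - y))\<^sup>2 \<le> f y - f x"
proof -
  obtain m where m: "m > 0" "\<And>u v. f (midpoint u v) \<le> (f u + f v) / 2 - m * (norm (u - v))\<^sup>2"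
    using assms(1) unfolding strongly_midconvex_def by blast
  have "2 * m * (norm (x - y))\<^sup>2 \<le> f y - f x" if "y \<in> S" for y
  proof -
    have "midpoint x y \<in> S"
      using midpoint_in_closed_segment closed_segment_subset assms that
      unfolding is_minimizer_def by blast
    then have "f x \<le> f (midpoint x y)" using assms(3) unfolding is_minimizer_def by blast
    then show ?thesis using m(2)[of x y] by argo
  qed
  then show ?thesis using that[of "2 * m"] m(1) by simp
qed

lemma is_minimizer_unique:
  assumes "strongly_midconvex f" "convex S" "is_minimizer f S x" "is_minimizer f S y"
  shows "x = y"
proof -
  obtain m where m: "m > 0" "\<And>y. y \<in> S \<Longrightarrow> m * (norm (x - y))\<^sup>2 \<le> f y - f x"
    using minimizer_gap[OF assms(1-3)] by blast
  have "y \<in> S" "f y \<le> f x" using assms(3,4) unfolding is_minimizer_def by auto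
  then have "m * (norm (x - y))\<^sup>2 \<le> 0" using m(2)[of y] by linarith
  then show ?thesis using m(1) by (simp add: mult_le_0_iff)
qed

lemma minimizer_eqI:
  assumes "strongly_midconvex f" "convex S" "is_minimizer f S x"
  shows "minimizer f S = x"
  unfolding minimizer_def using assms is_minimizer_unique[OF assms(1,2)]
  by (intro the_equality) auto

lemma is_minimizer_minimizer:
  fixes f :: "'a::euclidean_space \<Rightarrow> real"
  assumes "closed S" "convex S" "S \<noteq> {}"
    and "continuous_on UNIV f" "strongly_midconvex f" "\<And>v. norm v - b \<le> f v"
  shows "is_minimizer f S (minimizer f S)"
  using minimizer_exists[OF assms(1,3,4,6)] minimizer_eqI[OF assms(5,2)] by metis

lemma is_minimizer_image:
  assumes "\<And>v. g (\<phi> v) = f v" "is_minimizer f S x"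
  shows "is_minimizer g (\<phi> ` S) (\<phi> x)"
  using assms unfolding is_minimizer_def by auto

text \<open>Stability of constrained minimization. Points of \<open>S0\<close> and
  \<open>S k\<close> shadow each other, so \<open>f0\<close> is almost minimal at a point
  \<open>y'\<close> of \<open>S0\<close> near \<open>p k\<close>, and the quadratic gap forces
  \<open>y'\<close> close to \<open>x\<close>. The common coercivity constant \<open>b\<close> keeps
  the \<open>p k\<close> in one ball, where the functions are uniformly close.\<close>

lemma tendsto_minimizer:
  fixes f :: "'k \<Rightarrow> 'a::euclidean_space \<Rightarrow> real"
  assumes cont: "continuous_on UNIV f0"
    and conv: "strongly_midconvex f0" "convex S0"
    and min0: "is_minimizer f0 S0 x"
    and min: "eventually (\<lambda>k. is_minimizer (f k) (S k) (p k)) \<Phi>"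
    and close: "\<And>R e. e > 0 \<Longrightarrow> eventually (\<lambda>k. \<forall>v. norm v \<le> R \<longrightarrow> \<bar>f k v - f0 v\<bar> \<le> e) \<Phi>"
    and coercive: "eventually (\<lambda>k. \<forall>v. norm v - b \<le> f k v) \<Phi>"
    and S: "\<And>e. e > 0 \<Longrightarrow> eventually (\<lambda>k. (\<forall>y\<in>S k. \<exists>z\<in>S0. dist y z \<le> e) \<and>
                                            (\<forall>z\<in>S0. \<exists>y\<in>S k. dist z y \<le> e)) \<Phi>"
  shows "(p \<longlongrightarrow> x) \<Phi>"
proof (rule tendstoI)
  fix e :: real assume e: "e > 0"
  obtain m where m: "m > 0" "\<And>y. y \<in> S0 \<Longrightarrow> m * (norm (x - y))\<^sup>2 \<le> f0 y - f0 x"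
    using minimizer_gap[OF conv min0] by blast
  \<comment> \<open>Passing from \<open>f0 x\<close> to \<open>f0 y'\<close> costs four errors of
    size \<open>\<eta>\<close> in the steps \<open>1\<close> to \<open>5\<close>, of which
    \<open>3\<close> is exact; dividing by 5 leaves room for strictness.\<close>
  define \<eta> where "\<eta> = min 1 (m * (e/2)\<^sup>2 / 5)"
  have \<eta>: "0 < \<eta>" "\<eta> \<le> 1" "5 * \<eta> \<le> m * (e/2)\<^sup>2" using m e by (auto simp: \<eta>_def min_def)
  \<comment> \<open>A ball for \<open>x'\<close>, \<open>p k\<close> and \<open>y'\<close>. The
    second entry bounds \<open>p k\<close> through coercivity, with 2 units for the errors in
    \<open>1\<close> and \<open>2\<close> and one more for \<open>y'\<close>.\<close>
  define R where "R = max (norm x + 2) (f0 x + b + 3)"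
  have "uniformly_continuous_on (cball 0 R) f0"
    by (intro compact_uniformly_continuous compact_cball continuous_on_subset[OF cont]) simp
  from this[unfolded uniformly_continuous_on_def, rule_format, OF \<eta>(1)] obtain \<delta>0 where \<delta>0: "\<delta>0 > 0"
      "\<And>u v. u \<in> cball 0 R \<Longrightarrow> v \<in> cball 0 R \<Longrightarrow> dist v u < \<delta>0 \<Longrightarrow> dist (f0 v) (f0 u) < \<eta>"
    by blast
  define \<delta> where "\<delta> = min (\<delta>0 / 2) (min 1 (e / 3))"
  have \<delta>: "0 < \<delta>" "\<delta> < \<delta>0" "\<delta> \<le> 1" "\<delta> < e/2" using \<delta>0(1) e by (auto simp: \<delta>_def)
  show "eventually (\<lambda>k. dist (p k) x < e) \<Phi>"
    using min close[OF \<eta>(1), of R] coercive S[OF \<delta>(1)]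
  proof eventually_elim
    case (elim k)
    have xS: "x \<in> S0" using min0 unfolding is_minimizer_def by blast
    obtain x' where x': "x' \<in> S k" "dist x x' \<le> \<delta>" using elim(4) xS by blast
    obtain y' where y': "y' \<in> S0" "dist (p k) y' \<le> \<delta>" 
      using elim(1,4) unfolding is_minimizer_def by blast
    have x'R: "norm x' \<le> R" "norm x \<le> R"
      using x'(2) \<delta>(3) norm_triangle_ineq2[of x' x] by (auto simp: R_def dist_norm norm_minus_commute)
    have 1: "f k x' \<le> f0 x' + \<eta>" using elim(2)[rule_format, OF x'R(1)] by linarith
    have 2: "f0 x' \<le> f0 x + \<eta>" using \<delta>0(2)[of x' x] x'R x'(2) \<delta>(2) by (auto simp: dist_real_def dist_commute)
    have 3: "f k (p k) \<le> f k x'" using elim(1) x'(1) unfolding is_minimizer_def by blast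
    have pR': "norm (p k) \<le> R - 1" using elim(3)[rule_format, of "p k"] 1 2 3 \<eta> unfolding R_def by linarith
    have yR: "norm y' \<le> R" "norm (p k) \<le> R"
      using pR' y'(2) \<delta>(3) norm_triangle_ineq2[of y' "p k"] by (auto simp: dist_norm norm_minus_commute)
    have 4: "f0 (p k) \<le> f k (p k) + \<eta>" using elim(2)[rule_format, OF yR(2)] by linarith
    have 5: "f0 y' \<le> f0 (p k) + \<eta>" using \<delta>0(2)[of "p k" y'] yR y'(2) \<delta>(2)
      by (auto simp: dist_real_def dist_commute)
    have "m * (norm (x - y'))\<^sup>2 \<le> 4 * \<eta>" using m(2)[OF y'(1)] 1 2 3 4 5 by linarith
    also have "\<dots> < m * (e/2)\<^sup>2" using \<eta> by linarith
    finally have "(norm (x - y'))\<^sup>2 < (e/2)\<^sup>2" using m(1) by simp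
    then have "norm (x - y') < e/2" by (rule power_less_imp_less_base) (use e in simp)
    then show ?case using y'(2) \<delta>(4) dist_triangle[of "p k" x y'] by (simp add: dist_norm norm_minus_commute)
  qed
qed

lemma cSUP_le_cSUP_plus:
  fixes f :: "'i \<Rightarrow> real" and g :: "'j \<Rightarrow> real"
  assumes "I \<noteq> {}" "bdd_above (g ` J)" "\<And>i. i \<in> I \<Longrightarrow> \<exists>j\<in>J. f i \<le> g j + e"
  shows "(SUP i\<in>I. f i) \<le> (SUP j\<in>J. g j) + e"
proof (rule cSUP_least[OF assms(1)])
  fix i assume "i \<in> I"
  then obtain j where "j \<in> J" "f i \<le> g j + e" using assms(3) by blast
  then show "f i \<le> (SUP j\<in>J. g j) + e" using cSUP_upper[OF _ assms(2), of j] by linarith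
qed

lemma abs_norm_square_diff_le:
  fixes x y :: "'a::real_normed_vector"
  assumes "norm x \<le> C" "norm y \<le> C"
  shows "\<bar>(norm x)\<^sup>2 - (norm y)\<^sup>2\<bar> \<le> 2 * C * norm (x - y)"
proof -
  have "\<bar>(norm x)\<^sup>2 - (norm y)\<^sup>2\<bar> = (norm x + norm y) * \<bar>norm x - norm y\<bar>"
    by (simp add: power2_eq_square square_diff_square_factored abs_mult)
  also have "\<dots> \<le> (2 * C) * norm (x - y)"
    using assms norm_triangle_ineq3[of x y] order_trans[OF norm_ge_zero assms(1)]
    by (intro mult_mono) auto
  finally show ?thesis .
qed

section \<open>Moduli of continuity\<close>

text \<open>Only points with \<open>e \<le> f x\<close> matter. They form a compact set on which
  \<open>k\<close> has a positive minimum, since \<open>k x = 0\<close> would force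
  \<open>f x \<le> 0\<close>; the slope is the maximum of \<open>f\<close> there divided by that
  minimum.\<close>

lemma compact_affine_bound:
  fixes f k :: "'a::t2_space \<Rightarrow> real"
  assumes "compact X" "continuous_on X f" "continuous_on X k"
    and "\<And>x. x \<in> X \<Longrightarrow> 0 \<le> k x" "\<And>x. x \<in> X \<Longrightarrow> k x = 0 \<Longrightarrow> f x \<le> 0" and "e > 0"
  shows "\<exists>b\<ge>0. \<forall>x\<in>X. f x \<le> e + b * k x"
proof (cases "{x \<in> X. e \<le> f x} = {}")
  case True
  then show ?thesis by (intro exI[of _ 0]) auto
next
  case False
  have "closed {x \<in> X. e \<le> f x}"
    using assms(1,2) by (intro continuous_on_closed_Collect_le compact_imp_closed) auto
  then have "compact ({x \<in> X. e \<le> f x} \<inter> X)"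
    using assms(1) by (rule closed_Int_compact)
  then have Y: "compact {x \<in> X. e \<le> f x}" by (simp add: Int_absorb2)
  have c: "continuous_on {x \<in> X. e \<le> f x} k" "continuous_on {x \<in> X. e \<le> f x} f"
    using assms(2,3) by (auto elim: continuous_on_subset)
  obtain y where y: "y \<in> X" "e \<le> f y" "\<And>x. x \<in> X \<Longrightarrow> e \<le> f x \<Longrightarrow> k y \<le> k x"
    using continuous_attains_inf[OF Y False c(1)] by auto
  obtain z where z: "z \<in> X" "e \<le> f z" "\<And>x. x \<in> X \<Longrightarrow> e \<le> f x \<Longrightarrow> f x \<le> f z"
    using continuous_attains_sup[OF Y False c(2)] by auto
  have ky: "k y > 0" using assms(4,5)[OF y(1)] y(2) assms(6) by force
  have "f x \<le> e + f z / k y * k x" if "x \<in> X" for x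
  proof (cases "e \<le> f x")
    case True
    have "f x \<le> f z / k y * k y" using z(3)[OF that True] ky by simp
    also have "\<dots> \<le> f z / k y * k x"
      using y(3)[OF that True] z(2) assms(6) ky by (intro mult_left_mono) auto
    finally show ?thesis using assms(6) by linarith
  next
    case False
    have "0 \<le> f z / k y * k x" using z(2) assms(6) ky assms(4)[OF that] by simp
    then show ?thesis using False by linarith
  qed
  moreover have "0 \<le> f z / k y" using z(2) assms(6) ky by simp
  ultimately show ?thesis by blast
qed

text \<open>The third clause is a form of subadditivity: with smallness near 0 it makes
  \<open>\<omega>\<close> uniformly continuous on the nonnegative reals. Negative arguments are left
  unconstrained.\<close>

definition is_modulus :: "(real \<Rightarrow> real) \<Rightarrow> bool" where
  "is_modulus \<omega> \<longleftrightarrow> \<omega> 0 = 0 \<and> (\<forall>t\<ge>0. 0 \<le> \<omega> t) \<and>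
     (\<forall>s\<ge>0. \<forall>t\<ge>0. \<bar>\<omega> s - \<omega> t\<bar> \<le> \<omega> \<bar>s - t\<bar>) \<and>
     (\<forall>e>0. \<exists>d>0. \<forall>t. 0 \<le> t \<and> t \<le> d \<longrightarrow> \<omega> t < e)"

lemma is_modulusD:
  assumes "is_modulus \<omega>"
  shows "\<omega> 0 = 0" "0 \<le> t \<Longrightarrow> 0 \<le> \<omega> t"
    "0 \<le> s \<Longrightarrow> 0 \<le> t \<Longrightarrow> \<bar>\<omega> s - \<omega> t\<bar> \<le> \<omega> \<bar>s - t\<bar>"
    "e > 0 \<Longrightarrow> \<exists>d>0. \<forall>t. 0 \<le> t \<and> t \<le> d \<longrightarrow> \<omega> t < e"
  using assms unfolding is_modulus_def by simp_all

text \<open>The witness is the infimum of all affine functions of \<open>t\<close> that dominate \<open>f\<close> along \<open>k\<close>; being concave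
  with value 0 at 0, it is subadditive.\<close>

lemma subadditive_modulus_exists:
  fixes f k :: "'a \<Rightarrow> real"
  assumes k: "\<And>x. x \<in> X \<Longrightarrow> 0 \<le> k x"
    and bound: "\<And>e. e > 0 \<Longrightarrow> \<exists>b\<ge>0. \<forall>x\<in>X. f x \<le> e + b * k x"
  shows "\<exists>\<omega>. is_modulus \<omega> \<and> (\<forall>x\<in>X. f x \<le> \<omega> (k x))"
proof -
  define P where "P = {(a,b). 0 \<le> a \<and> 0 \<le> b \<and> (\<forall>x\<in>X. f x \<le> a + b * k x)}"
  define \<omega> where "\<omega> t = (INF (a,b)\<in>P. a + b * t)" for t :: real
  have ne: "P \<noteq> {}"
  proof -
    obtain b where "b \<ge> 0" "\<forall>x\<in>X. f x \<le> 1 + b * k x" using bound[of 1] by auto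
    then have "(1, b) \<in> P" by (simp add: P_def)
    then show ?thesis by blast
  qed
  have bdd: "bdd_below ((\<lambda>(a,b). a + b * t) ` P)" if "0 \<le> t" for t
    using that by (intro bdd_belowI[of _ 0]) (auto simp: P_def)
  have upper: "\<omega> t \<le> a + b * t" if "(a,b) \<in> P" "0 \<le> t" for a b t
    using cINF_lower[OF bdd[OF that(2)] that(1)] unfolding \<omega>_def by simp
  have greatest: "c \<le> \<omega> t" if "\<And>a b. (a,b) \<in> P \<Longrightarrow> c \<le> a + b * t" for c t
    using ne that unfolding \<omega>_def by (intro cINF_greatest) auto
  have nonneg: "0 \<le> \<omega> t" if "0 \<le> t" for t
    using that by (intro greatest) (auto simp: P_def)
  have dom: "f x \<le> \<omega> (k x)" if "x \<in> X" for x
    using that by (intro greatest) (auto simp: P_def)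
  have mono: "\<omega> s \<le> \<omega> t" if "0 \<le> s" "s \<le> t" for s t
  proof (rule greatest)
    fix a b assume ab: "(a,b) \<in> P"
    have "b * s \<le> b * t" using ab that by (intro mult_left_mono) (auto simp: P_def)
    then show "\<omega> s \<le> a + b * t" using upper[OF ab that(1)] by linarith
  qed
  have sub: "\<omega> (s + t) \<le> \<omega> s + \<omega> t" if st: "0 \<le> s" "0 \<le> t" for s t
  proof -
    \<comment> \<open>Of the two affine majorants the one with the smaller slope is evaluated at
      \<open>s + t\<close>; raising its slope on one summand and adding the other constant term only
      increases the bound.\<close>
    have *: "\<omega> (s + t) \<le> (a + b * s) + (a' + b' * t)" if ab: "(a,b) \<in> P" "(a',b') \<in> P" for a b a' b'
    proof (cases "b \<le> b'")
      case True
      have "b * t \<le> b' * t" using True st by (intro mult_right_mono) auto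
      then show ?thesis using upper[OF ab(1), of "s + t"] ab st by (auto simp: P_def algebra_simps)
    next
      case False
      have "b' * s \<le> b * s" using False st by (intro mult_right_mono) auto
      then show ?thesis using upper[OF ab(2), of "s + t"] ab st by (auto simp: P_def algebra_simps)
    qed
    have "\<omega> (s + t) - \<omega> t \<le> a + b * s" if "(a,b) \<in> P" for a b
    proof -
      have "\<omega> (s + t) - (a + b * s) \<le> \<omega> t" using *[OF that] by (intro greatest) (simp add: algebra_simps)
      then show ?thesis by linarith
    qed
    then have "\<omega> (s + t) - \<omega> t \<le> \<omega> s" by (rule greatest)
    then show ?thesis by linarith
  qed
  have diff: "\<bar>\<omega> s - \<omega> t\<bar> \<le> \<omega> \<bar>s - t\<bar>" if "0 \<le> s" "0 \<le> t" for s t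
  proof (cases "s \<le> t")
    case True
    then show ?thesis using sub[of s "t - s"] mono[of s t] nonneg[of 0] that by (auto simp: abs_if)
  next
    case False
    then show ?thesis using sub[of t "s - t"] mono[of t s] that by (simp add: abs_if)
  qed
  have small: "\<exists>d>0. \<forall>t. 0 \<le> t \<and> t \<le> d \<longrightarrow> \<omega> t < e" if e: "e > 0" for e
  proof -
    obtain b where b: "b \<ge> 0" "\<forall>x\<in>X. f x \<le> e/2 + b * k x" using bound[of "e/2"] e by auto
    then have "(e/2, b) \<in> P" using e by (auto simp: P_def)
    \<comment> \<open>The \<open>+ 1\<close> keeps the threshold positive when
      \<open>b = 0\<close>.\<close>
    moreover have "e/2 + b * t < e" if "0 \<le> t" "t \<le> e / (4 * (b + 1))" for t
    proof -
      have "b * t \<le> b * (e / (4 * (b + 1)))" using that b by (intro mult_left_mono) auto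
      also have "\<dots> \<le> e / 4" using b e by (simp add: field_simps)
      finally show ?thesis using e by linarith
    qed
    ultimately have "\<omega> t < e" if "0 \<le> t" "t \<le> e / (4 * (b + 1))" for t
      using upper[of "e/2" b t] that by force
    moreover have "e / (4 * (b + 1)) > 0" using e b by simp
    ultimately show ?thesis by blast
  qed
  \<comment> \<open>If \<open>\<omega> 0\<close> were positive, smallness with
    \<open>e = \<omega> 0\<close> would give \<open>\<omega> 0 < \<omega> 0\<close>.\<close>
  have zero: "\<omega> 0 = 0"
    using nonneg[of 0] small[of "\<omega> 0"] by force
  show ?thesis
    using nonneg dom diff small zero by (intro exI[of _ \<omega>]) (simp add: is_modulus_def)
qed

section \<open>Hausdorff distance of convex bodies\<close>

lemma convex_bodyD:
  assumes "K \<in> convex_bodies"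
  shows "compact K" "convex K" "closed K" "bounded K" "K \<noteq> {}"
  using assms by (auto simp: convex_bodies_def compact_imp_closed compact_imp_bounded)

lemma hausdorff_dist_attained:
  fixes K L :: "'a::heine_borel set"
  assumes "compact K" "compact L" "L \<noteq> {}" "x \<in> K"
  shows "\<exists>y\<in>L. dist x y \<le> hausdorff_dist K L"
  using infdist_attains_inf[of L x] infdist_le_hausdorff_dist[of x K L] assms
  by (metis compact_imp_bounded compact_imp_closed)

lemma hausdorff_dist_le_dist:
  assumes "K \<noteq> {}" "L \<noteq> {}" "0 \<le> e"
    and "\<And>x. x \<in> K \<Longrightarrow> \<exists>y\<in>L. dist x y \<le> e" "\<And>y. y \<in> L \<Longrightarrow> \<exists>x\<in>K. dist y x \<le> e"
  shows "hausdorff_dist K L \<le> e"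
  using assms by (intro hausdorff_dist_leI) (meson infdist_le2)+

lemma hausdorff_dist_image_le:
  assumes "K \<noteq> {}" "0 \<le> e" "\<And>x. x \<in> K \<Longrightarrow> dist (f x) (g x) \<le> e"
  shows "hausdorff_dist (f ` K) (g ` K) \<le> e"
  using assms by (intro hausdorff_dist_le_dist) (force simp: dist_commute)+

lemmas hausdorff_dist_triangle = Metric_space.triangle[OF Metric_space_convex_bodies]
lemmas hausdorff_dist_eq_0 = Metric_space.zero[OF Metric_space_convex_bodies]

text \<open>The quadrilateral inequality: two applications of the triangle inequality in each
  direction.\<close>

lemma abs_hausdorff_dist_diff_le:
  fixes K L K' L' :: "(real^'n) set"
  assumes "K \<in> convex_bodies" "L \<in> convex_bodies" "K' \<in> convex_bodies" "L' \<in> convex_bodies"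
  shows "\<bar>hausdorff_dist K L - hausdorff_dist K' L'\<bar> \<le> hausdorff_dist K K' + hausdorff_dist L L'"
  using hausdorff_dist_triangle[OF assms(1,3,2)] hausdorff_dist_triangle[OF assms(3,4,2)]
    hausdorff_dist_triangle[OF assms(3,1,4)] hausdorff_dist_triangle[OF assms(1,2,4)]
    hausdorff_dist_commute[of K K'] hausdorff_dist_commute[of L L']
  by linarith

lemma convex_body_translation:
  assumes "K \<in> convex_bodies" shows "(\<lambda>x. x - c) ` K \<in> convex_bodies"
  using assms interior_translation_subtract[of c K]
  by (auto simp: convex_bodies_def compact_translation_subtract convex_translation_subtract)

lemma convex_body_linear_image:
  fixes A :: "real^'n^'n"
  assumes "K \<in> convex_bodies" "invertible A"
  shows "(*v) A ` K \<in> convex_bodies"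
proof -
  have "inj ((*v) A)" using assms(2) by (simp add: invertible_eq_bij bij_is_inj)
  then have "interior ((*v) A ` K) = (*v) A ` interior K"
    by (intro interior_injective_linear_image) auto
  then show ?thesis using assms(1)
    by (auto simp: convex_bodies_def convex_linear_image
        intro!: compact_continuous_image matrix_vector_mult_linear_continuous_on)
qed

lemma eventually_near_body:
  fixes K :: "(real^'n) set"
  assumes "e > 0"
  shows "eventually (\<lambda>L. L \<in> convex_bodies \<and> hausdorff_dist L K < e) (atin hausdorff_topology K)"
  unfolding hausdorff_topology_def
    Metric_space.eventually_atin_metric[OF Metric_space_convex_bodies]
  using assms by blast

lemma continuous_map_hausdorff_iff:
  fixes p :: "(real^'n) set \<Rightarrow> real^'n"
  shows "continuous_map hausdorff_topology euclidean p \<longleftrightarrow>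
    (\<forall>K\<in>convex_bodies. (p \<longlongrightarrow> p K) (atin hausdorff_topology K))"
  by (simp add: continuous_map_atin hausdorff_topology_def
      Metric_space.topspace_mtopology[OF Metric_space_convex_bodies])

lemma hausdorff_dist_translation_le:
  fixes K L :: "(real^'n) set"
  assumes "K \<in> convex_bodies" "L \<in> convex_bodies"
  shows "hausdorff_dist ((\<lambda>x. x - c) ` K) ((\<lambda>x. x - d) ` L) \<le> hausdorff_dist K L + dist c d"
proof -
  have *: "dist (x - c) (y - d) \<le> e + dist c d" "dist (y - d) (x - c) \<le> e + dist c d"
    if "dist x y \<le> e" for x y :: "real^'n" and e
    using norm_triangle_ineq4[of "x - y" "c - d"] that
    by (auto simp: dist_norm algebra_simps norm_minus_commute)
  have 1: "\<exists>y\<in>L. dist x y \<le> hausdorff_dist K L" if "x \<in> K" for x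
    using that assms by (intro hausdorff_dist_attained) (auto simp: convex_bodyD)
  have 2: "\<exists>y\<in>K. dist y x \<le> hausdorff_dist K L" if "x \<in> L" for x
    using hausdorff_dist_attained[of L K x] that assms
    by (simp add: convex_bodyD hausdorff_dist_commute dist_commute)
  show ?thesis
  proof (rule hausdorff_dist_le_dist)
    show "0 \<le> hausdorff_dist K L + dist c d" using hausdorff_dist_nonneg[of K L] by simp
  next
    fix x assume "x \<in> (\<lambda>x. x - c) ` K"
    then show "\<exists>y\<in>(\<lambda>x. x - d) ` L. dist x y \<le> hausdorff_dist K L + dist c d"
      using 1 *(1) by (auto simp: bex_simps) blast
  next
    fix x assume "x \<in> (\<lambda>x. x - d) ` L"
    then show "\<exists>y\<in>(\<lambda>x. x - c) ` K. dist x y \<le> hausdorff_dist K L + dist c d"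
      using 2 *(2) by (auto simp: bex_simps) blast
  qed (use assms in \<open>auto simp: convex_bodyD\<close>)
qed

lemma eventually_bodies_close:
  fixes K :: "(real^'n) set"
  assumes "K \<in> convex_bodies" "e > 0"
  shows "eventually (\<lambda>L. L \<in> convex_bodies \<and> (\<forall>y\<in>L. \<exists>z\<in>K. dist y z \<le> e) \<and> (\<forall>z\<in>K. \<exists>y\<in>L. dist z y \<le> e))
           (atin hausdorff_topology K)"
  using eventually_near_body[OF assms(2), of K]
proof eventually_elim
  case (elim L)
  have "\<exists>z\<in>K. dist y z \<le> e" if "y \<in> L" for y
    using hausdorff_dist_attained[of L K y] that elim assms(1) by (force simp: convex_bodyD)
  moreover have "\<exists>y\<in>L. dist z y \<le> e" if "z \<in> K" for z
    using hausdorff_dist_attained[of K L z] that elim assms(1) hausdorff_dist_commute[of K L]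
    by (force simp: convex_bodyD)
  ultimately show ?case using elim by blast
qed

section \<open>The affine group\<close>

lemma BijGroup_mult:
  assumes "f \<in> carrier (BijGroup UNIV)" "g \<in> carrier (BijGroup UNIV)"
  shows "f \<otimes>\<^bsub>BijGroup UNIV\<^esub> g = (\<lambda>x. f (g x))"
  using assms by (auto simp: BijGroup_def compose_def)

lemma affine_mem_affine_group:
  fixes G :: "(real^'n^'n) set"
  assumes "subgroup G GL" "A \<in> G"
  shows "(\<lambda>x. t + A *v x) \<in> affine_group G"
proof -
  let ?S = "range (\<lambda>v x. v + x) \<union> (*v) ` G"
  have S: "?S \<subseteq> carrier (BijGroup UNIV)"
    by (rule affine_group_generators[OF subgroup.subset[OF assms(1)]])
  have mem: "(\<lambda>x. t + x) \<in> ?S" "(*v) A \<in> ?S" using assms(2) by auto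
  have "(\<lambda>x. t + x) \<otimes>\<^bsub>BijGroup UNIV\<^esub> (*v) A \<in> affine_group G"
    unfolding affine_group_def by (intro generate.eng generate.incl mem)
  then show ?thesis
    unfolding BijGroup_mult[OF subsetD[OF S mem(1)] subsetD[OF S mem(2)]] .
qed

text \<open>Together with \<open>affine_mem_affine_group\<close> this identifies the generated group
  with the maps \<open>x \<mapsto> t + A x\<close>, \<open>A\<close> in \<open>G\<close>. In a
  composition the inner shift \<open>t2\<close> becomes \<open>A1 *v t2\<close>, so the normal form
  is preserved.\<close>

lemma affine_group_affine:
  fixes G :: "(real^'n^'n) set"
  assumes G: "subgroup G GL" and f: "f \<in> affine_group G"
  shows "\<exists>t. \<exists>A\<in>G. f = (\<lambda>x. t + A *v x)"
proof -
  let ?S = "range (\<lambda>v x. v + x) \<union> (*v) ` G"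
  let ?B = "BijGroup (UNIV :: (real^'n) set)"
  interpret B: group ?B by (rule group_BijGroup)
  have S: "?S \<subseteq> carrier ?B"
    by (rule affine_group_generators[OF subgroup.subset[OF G]])
  have one: "mat 1 \<in> G" using subgroup.one_closed[OF G] by (simp add: GL_def)
  have "f \<in> generate ?B ?S" using f unfolding affine_group_def .
  then show ?thesis
  proof induction
    case one
    have "\<one>\<^bsub>?B\<^esub> = (\<lambda>x. 0 + mat 1 *v x)" by (auto simp: BijGroup_def)
    then show ?case using \<open>mat 1 \<in> G\<close> by blast
  next
    case (incl h)
    then show ?case
    proof
      assume "h \<in> range (\<lambda>v x. v + x)"
      then obtain v where "h = (\<lambda>x. v + mat 1 *v x)" by auto
      then show ?thesis using one by blast
    next
      assume "h \<in> (*v) ` G"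
      then obtain A where "A \<in> G" "h = (\<lambda>x. 0 + A *v x)" by auto
      then show ?thesis by blast
    qed
  next
    case (inv h)
    \<comment> \<open>\<open>generate\<close> inverts generators only, and the inverse of a shift or
      of a matrix in \<open>G\<close> is again a generator; a left inverse suffices in a
      group.\<close>
    have inv_eq: "inv\<^bsub>?B\<^esub> h = g" if "g \<in> ?S" "\<And>x. g (h x) = x" for g
    proof (rule B.inv_equality)
      show "g \<otimes>\<^bsub>?B\<^esub> h = \<one>\<^bsub>?B\<^esub>"
        using BijGroup_mult[of g h] S inv that by (auto simp: BijGroup_def)
    qed (use S inv that in blast)+
    from inv show ?case
    proof
      assume "h \<in> range (\<lambda>v x. v + x)"
      then obtain v where v: "h = (\<lambda>x. v + x)" by blast
      have "inv\<^bsub>?B\<^esub> h = (\<lambda>x. - v + x)" 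
        by (rule inv_eq) (rule UnI1, rule rangeI, simp add: v)
      then have "inv\<^bsub>?B\<^esub> h = (\<lambda>x. - v + mat 1 *v x)" by simp
      then show ?thesis using one by blast
    next
      assume "h \<in> (*v) ` G"
      then obtain A where A: "A \<in> G" "h = (*v) A" by blast
      have AC: "A \<in> carrier GL" using subgroup.subset[OF G] A by blast
      have "inv\<^bsub>GL\<^esub> A ** A = mat 1"
        using group.l_inv[OF group_GL AC] by (simp add: GL_def)
      moreover have "inv\<^bsub>GL\<^esub> A \<in> G" by (rule subgroup.m_inv_closed[OF G A(1)])
      ultimately have "inv\<^bsub>?B\<^esub> h = (*v) (inv\<^bsub>GL\<^esub> A)"
        by (intro inv_eq) (auto simp: A(2) matrix_vector_mul_assoc)
      then have "inv\<^bsub>?B\<^esub> h = (\<lambda>x. 0 + (inv\<^bsub>GL\<^esub> A) *v x)" by simp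
      then show ?thesis using \<open>inv\<^bsub>GL\<^esub> A \<in> G\<close> by blast
    qed
  next
    case (eng h1 h2)
    then obtain t1 A1 t2 A2 where h: "A1 \<in> G" "h1 = (\<lambda>x. t1 + A1 *v x)" "A2 \<in> G" "h2 = (\<lambda>x. t2 + A2 *v x)"
      by blast
    have "h1 \<otimes>\<^bsub>?B\<^esub> h2 = (\<lambda>x. h1 (h2 x))"
      using eng.hyps B.generate_incl[OF S] by (intro BijGroup_mult) auto
    also have "\<dots> = (\<lambda>x. (t1 + A1 *v t2) + (A1 ** A2) *v x)"
      by (simp add: h matrix_vector_right_distrib matrix_vector_mul_assoc add.assoc)
    finally have "h1 \<otimes>\<^bsub>?B\<^esub> h2 = (\<lambda>x. (t1 + A1 *v t2) + (A1 ** A2) *v x)" .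
    moreover have "A1 ** A2 \<in> G"
      using subgroup.m_closed[OF G h(1,3)] by (simp add: GL_def)
    ultimately show ?case by blast
  qed
qed

text \<open>For an automorphism \<open>A\<close> of \<open>K\<close>, equivariance reads
  \<open>A (p K) = p K\<close>. This is the easy inclusion in the description of the values at
  \<open>K\<close>.\<close>

lemma invariant_point_fixed:
  assumes "invariant_point \<Phi> p" "K \<in> convex_bodies"
  shows "p K \<in> fixed_points (body_automorphisms \<Phi> K)"
  using assms unfolding invariant_point_def fixed_points_def body_automorphisms_def by force

section \<open>Compact matrix groups\<close>

text \<open>Cauchy-Schwarz in each row, then a sum over the rows. The factor \<open>CARD('m)\<close>
  is crude but harmless in the boundedness and continuity arguments below.\<close>

lemma norm_matrix_vector_mult_le:
  fixes A :: "real^'n^'m"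
  shows "norm (A *v x) \<le> real CARD('m) * norm A * norm x"
proof -
  have "norm (A *v x) \<le> (\<Sum>i\<in>UNIV. \<bar>(A *v x) $ i\<bar>)" by (rule norm_le_l1_cart)
  also have "\<dots> \<le> (\<Sum>i\<in>(UNIV::'m set). norm A * norm x)"
  proof (rule sum_mono)
    fix i :: 'm
    have "\<bar>(A *v x) $ i\<bar> \<le> norm (A $ i) * norm x"
      by (simp add: matrix_vector_mul_component Cauchy_Schwarz_ineq2)
    also have "\<dots> \<le> norm A * norm x"
      by (intro mult_right_mono Finite_Cartesian_Product.norm_nth_le) simp
    finally show "\<bar>(A *v x) $ i\<bar> \<le> norm A * norm x" .
  qed
  finally show ?thesis by simp
qed

text \<open>The parallelogram law, the source of strong convexity below.\<close>

lemma norm_half_sum_square: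
  fixes x y :: "'a::real_inner"
  shows "(norm ((1/2) *\<^sub>R (x + y)))\<^sup>2 = ((norm x)\<^sup>2 + (norm y)\<^sup>2) / 2 - (norm (x - y))\<^sup>2 / 4"
  by (simp add: power2_norm_eq_inner inner_add inner_diff inner_commute[of y x] field_simps)

text \<open>Group axioms for plain matrix products keep the record \<open>GL\<close> and its inverse
  operator out of the estimates.\<close>

locale compact_matrix_group =
  fixes G :: "(real^'n^'n) set"
  assumes compact_G: "compact G" and one_mem: "mat 1 \<in> G"
    and mult_mem: "A \<in> G \<Longrightarrow> B \<in> G \<Longrightarrow> A ** B \<in> G"
    and inv_mem: "A \<in> G \<Longrightarrow> \<exists>B\<in>G. A ** B = mat 1 \<and> B ** A = mat 1"
begin

lemma operator_bound_exists: "\<exists>M\<ge>1. \<forall>A\<in>G. \<forall>x. norm (A *v x) \<le> M * norm x"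
proof -
  obtain C where C: "\<And>A. A \<in> G \<Longrightarrow> norm A \<le> C"
    using compact_imp_bounded[OF compact_G] unfolding bounded_iff by blast
  have "norm (A *v x) \<le> max 1 (real CARD('n) * C) * norm x" if "A \<in> G" for A x
  proof -
    have "norm (A *v x) \<le> (real CARD('n) * norm A) * norm x" by (rule norm_matrix_vector_mult_le)
    also have "\<dots> \<le> (real CARD('n) * C) * norm x"
      using C[OF that] by (intro mult_right_mono mult_left_mono) auto
    also have "\<dots> \<le> max 1 (real CARD('n) * C) * norm x"
      by (intro mult_right_mono) auto
    finally show ?thesis .
  qed
  then show ?thesis by (intro exI[of _ "max 1 (real CARD('n) * C)"]) auto
qed

text \<open>Any common bound for the operator norms serves, so one is chosen once and for all; a
  value of at least 1 can safely be divided by and multiplied into inequalities.\<close>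

definition M :: real where
  "M = (SOME M. M \<ge> 1 \<and> (\<forall>A\<in>G. \<forall>x. norm (A *v x) \<le> M * norm x))"

lemma M_ge_1: "1 \<le> M" and norm_le_M: "A \<in> G \<Longrightarrow> norm (A *v x) \<le> M * norm x"
  using someI_ex[OF operator_bound_exists] unfolding M_def by auto

text \<open>The upper bound applied to the inverse matrix, which also lies in \<open>G\<close>. It
  makes the convexity constant uniform over the group.\<close>

lemma norm_ge_M:
  assumes "A \<in> G" shows "norm x \<le> M * norm (A *v x)"
proof -
  obtain B where B: "B \<in> G" "B ** A = mat 1" using inv_mem[OF assms] by blast
  then show ?thesis using norm_le_M[OF B(1), of "A *v x"] by (simp add: matrix_vector_mul_assoc)
qed

text \<open>Right translation by \<open>A\<close> maps \<open>G\<close> onto itself; this is what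
  reindexes the suprema over \<open>G\<close> below.\<close>

lemma mem_right_translate:
  assumes "A \<in> G" "h \<in> G" obtains h' where "h' \<in> G" "h = h' ** A"
proof -
  obtain B where B: "B \<in> G" "B ** A = mat 1" using inv_mem[OF assms(1)] by blast
  then have "h = (h ** B) ** A" by (simp add: matrix_mul_assoc[symmetric])
  then show ?thesis using that mult_mem[OF assms(2) B(1)] by blast
qed

lemma invertible_mem: "A \<in> G \<Longrightarrow> invertible A"
  using inv_mem unfolding invertible_def by blast

lemma image_mem: "A \<in> G \<Longrightarrow> K \<in> convex_bodies \<Longrightarrow> (*v) A ` K \<in> convex_bodies"
  by (simp add: convex_body_linear_image invertible_mem)

lemma hausdorff_dist_linear_image_le:
  assumes "A \<in> G" "K \<in> convex_bodies" "L \<in> convex_bodies"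
  shows "hausdorff_dist ((*v) A ` K) ((*v) A ` L) \<le> M * hausdorff_dist K L"
proof -
  have *: "dist (A *v x) (A *v y) \<le> M * e" if "dist x y \<le> e" for x y e
  proof -
    have "dist (A *v x) (A *v y) \<le> M * dist x y"
      using norm_le_M[OF assms(1), of "x - y"]
      by (simp add: dist_norm matrix_vector_mult_diff_distrib)
    also have "\<dots> \<le> M * e" using that M_ge_1 by (intro mult_left_mono) auto
    finally show ?thesis .
  qed
  have 1: "\<exists>y\<in>L. dist x y \<le> hausdorff_dist K L" if "x \<in> K" for x
    using that assms by (intro hausdorff_dist_attained) (auto simp: convex_bodyD)
  have 2: "\<exists>y\<in>K. dist x y \<le> hausdorff_dist K L" if "x \<in> L" for x
    using hausdorff_dist_attained[of L K x] that assms
    by (simp add: convex_bodyD hausdorff_dist_commute)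
  show ?thesis
  proof (rule hausdorff_dist_le_dist)
    show "0 \<le> M * hausdorff_dist K L" using M_ge_1 hausdorff_dist_nonneg[of K L] by simp
  qed (use assms 1 2 * in \<open>auto simp: convex_bodyD; blast\<close>)+
qed

section \<open>Distances between images of bodies under the group\<close>

text \<open>A function of the pair, since \<open>G \<times> G\<close> serves both as the compact
  domain of the modulus argument and as the index set of \<open>penalized\<close>.\<close>

definition orbit_dist :: "(real^'n) set \<Rightarrow> (real^'n) set \<Rightarrow> (real^'n^'n) \<times> (real^'n^'n) \<Rightarrow> real" where
  "orbit_dist K L = (\<lambda>(h, g). hausdorff_dist ((*v) h ` K) ((*v) g ` L))"

lemma orbit_dist_nonneg: "0 \<le> orbit_dist K L i"
  by (simp add: orbit_dist_def hausdorff_dist_nonneg split: prod.split)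

text \<open>As \<open>K\<close> is bounded, the image of \<open>K\<close> under \<open>h\<close> is
  Lipschitz in \<open>h\<close> for the Hausdorff distance; the quadrilateral inequality transfers
  this to the distance of two images.\<close>

lemma continuous_on_orbit_dist:
  assumes K: "K \<in> convex_bodies"
  shows "continuous_on (G \<times> G) (orbit_dist K K)"
proof -
  obtain r where r: "\<And>x. x \<in> K \<Longrightarrow> norm x \<le> r" "r > 0"
    using convex_bodyD(4)[OF K] unfolding bounded_pos by blast
  have close: "hausdorff_dist ((*v) h ` K) ((*v) h' ` K) \<le> real CARD('n) * r * norm (h - h')"
    for h h' :: "real^'n^'n"
  proof (rule hausdorff_dist_image_le)
    fix x assume "x \<in> K"
    have "dist (h *v x) (h' *v x) \<le> real CARD('n) * norm (h - h') * norm x"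
      using norm_matrix_vector_mult_le[of "h - h'" x]
      by (simp add: dist_norm matrix_vector_mult_diff_rdistrib)
    also have "\<dots> \<le> real CARD('n) * norm (h - h') * r"
      using r(1)[OF \<open>x \<in> K\<close>] by (intro mult_left_mono) auto
    finally show "dist (h *v x) (h' *v x) \<le> real CARD('n) * r * norm (h - h')" by (simp add: mult_ac)
  qed (use convex_bodyD(5)[OF K] r in auto)
  have "((\<lambda>i. orbit_dist K K i) \<longlongrightarrow> orbit_dist K K j) (at j within G \<times> G)" if j: "j \<in> G \<times> G" for j
  proof -
    have "((\<lambda>i. norm (fst i - fst j) + norm (snd i - snd j)) \<longlongrightarrow>
        norm (fst j - fst j) + norm (snd j - snd j)) (at j within G \<times> G)"
      by (intro tendsto_intros)
    then have lim: "((\<lambda>i. norm (fst i - fst j) + norm (snd i - snd j)) \<longlongrightarrow> 0) (at j within G \<times> G)"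
      by simp
    have "norm (orbit_dist K K i - orbit_dist K K j) \<le>
       norm (norm (fst i - fst j) + norm (snd i - snd j)) * (real CARD('n) * r)" if i: "i \<in> G \<times> G" for i
    proof -
      have "\<bar>orbit_dist K K i - orbit_dist K K j\<bar> \<le>
         hausdorff_dist ((*v) (fst i) ` K) ((*v) (fst j) ` K) +
         hausdorff_dist ((*v) (snd i) ` K) ((*v) (snd j) ` K)"
        using i j K unfolding orbit_dist_def
        by (auto intro!: abs_hausdorff_dist_diff_le image_mem)
      then show ?thesis using close[of "fst i" "fst j"] close[of "snd i" "snd j"]
        by (simp add: algebra_simps)
    qed
    then have "eventually (\<lambda>i. norm (orbit_dist K K i - orbit_dist K K j) \<le>
       norm (norm (fst i - fst j) + norm (snd i - snd j)) * (real CARD('n) * r)) (at j within G \<times> G)"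
      by (simp add: eventually_at_filter)
    from tendsto_0_le[OF lim this] show ?thesis by (rule LIM_zero_cancel)
  qed
  then show ?thesis by (simp add: continuous_on_def)
qed

section \<open>Suprema of penalized squared distances\<close>

text \<open>The common shape of the two objectives \<open>spread\<close> and
  \<open>penalized\<close>, so that finiteness, coercivity, convexity and continuity are proved
  once.\<close>

definition sup_form ::
    "'i set \<Rightarrow> ('i \<Rightarrow> real^'n^'n) \<Rightarrow> ('i \<Rightarrow> real^'n) \<Rightarrow> ('i \<Rightarrow> real) \<Rightarrow> real^'n \<Rightarrow> real" where
  "sup_form I h a b v = (SUP i\<in>I. (norm (h i *v v - a i))\<^sup>2 - b i)"

text \<open>These conditions make the supremum finite: matrices from \<open>G\<close> and bounded
  targets \<open>a\<close> bound the squares, and nonnegative \<open>b\<close> only lowers the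
  terms.\<close>

definition bounded_family ::
    "'i set \<Rightarrow> ('i \<Rightarrow> real^'n^'n) \<Rightarrow> ('i \<Rightarrow> real^'n) \<Rightarrow> ('i \<Rightarrow> real) \<Rightarrow> bool" where
  "bounded_family I h a b \<longleftrightarrow> I \<noteq> {} \<and> h ` I \<subseteq> G \<and> bounded (a ` I) \<and> (\<forall>i\<in>I. 0 \<le> b i)"

lemma bounded_family_norm_le:
  assumes "bounded_family I h a b"
  obtains r where "0 < r" "\<And>i v. i \<in> I \<Longrightarrow> norm (h i *v v - a i) \<le> M * norm v + r"
proof -
  obtain r where r: "0 < r" "\<And>i. i \<in> I \<Longrightarrow> norm (a i) \<le> r"
    using assms unfolding bounded_family_def bounded_pos by auto
  have "norm (h i *v v - a i) \<le> M * norm v + r" if "i \<in> I" for i v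
    using norm_triangle_ineq4[of "h i *v v" "a i"] norm_le_M[of "h i" v] r(2)[OF that] assms that
    unfolding bounded_family_def by force
  then show ?thesis using that r(1) by blast
qed

lemma bdd_above_sup_form:
  assumes "bounded_family I h a b"
  shows "bdd_above ((\<lambda>i. (norm (h i *v v - a i))\<^sup>2 - b i) ` I)"
proof -
  obtain r where r: "\<And>i v. i \<in> I \<Longrightarrow> norm (h i *v v - a i) \<le> M * norm v + r"
    using bounded_family_norm_le[OF assms] by blast
  have "(norm (h i *v v - a i))\<^sup>2 - b i \<le> (M * norm v + r)\<^sup>2" if "i \<in> I" for i
    using power_mono[OF r[OF that, of v] norm_ge_zero, of 2] assms that
    unfolding bounded_family_def by force
  then show ?thesis by (rule bdd_aboveI2)
qed

lemma sup_form_ge: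
  assumes "bounded_family I h a b" "i \<in> I"
  shows "(norm (h i *v v - a i))\<^sup>2 - b i \<le> sup_form I h a b v"
  unfolding sup_form_def by (rule cSUP_upper[OF assms(2) bdd_above_sup_form[OF assms(1)]])

text \<open>A single term with identity matrix already grows fast enough. The bound involves no
  other index, so coercivity is easy to keep uniform when the family varies.\<close>

lemma sup_form_coercive:
  assumes "bounded_family I h a b" "i \<in> I" "h i = mat 1"
  shows "norm v - (norm (a i) + 1 + b i) \<le> sup_form I h a b v"
proof -
  have "norm v - norm (a i) - 1 \<le> norm (v - a i) - 1"
    using norm_triangle_ineq2[of v "a i"] by simp
  \<comment> \<open>With \<open>t = norm (v - a i)\<close>, the square of \<open>t - 1/2\<close> is
    nonnegative, so \<open>t\<^sup>2 \<ge> t - 1/4 \<ge> t - 1\<close>.\<close>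
  also have "\<dots> \<le> (norm (v - a i))\<^sup>2"
    using zero_le_power2[of "norm (v - a i) - 1/2"] by (simp add: power2_eq_square algebra_simps)
  finally show ?thesis using sup_form_ge[OF assms(1,2), of v] assms(3) by simp
qed

text \<open>Each term is a squared norm after an affine map, so the parallelogram law gives
  midconvexity with a quadratic gain; \<open>norm_ge_M\<close> makes the gain uniform in
  \<open>i\<close>, and therefore it survives the supremum.\<close>

lemma strongly_midconvex_sup_form:
  assumes "bounded_family I h a b"
  shows "strongly_midconvex (sup_form I h a b)"
proof -
  \<comment> \<open>The quarter comes from the parallelogram law, \<open>M\<^sup>2\<close> from
    \<open>norm_ge_M\<close>.\<close>
  define m where "m = 1 / (4 * M\<^sup>2)"
  have m: "m > 0" using M_ge_1 by (simp add: m_def)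
  have "sup_form I h a b (midpoint u v) \<le>
      (sup_form I h a b u + sup_form I h a b v) / 2 - m * (norm (u - v))\<^sup>2" for u v
    unfolding sup_form_def[of I h a b "midpoint u v"]
  proof (rule cSUP_least)
    show "I \<noteq> {}" using assms unfolding bounded_family_def by blast
    fix i assume i: "i \<in> I"
    let ?p = "h i *v u - a i" and ?q = "h i *v v - a i"
    have mid: "h i *v midpoint u v - a i = (1/2) *\<^sub>R (?p + ?q)"
      by (simp add: midpoint_def matrix_vector_mult_scaleR matrix_vector_right_distrib vec_eq_iff
          algebra_simps)
    have "h i \<in> G" using assms i unfolding bounded_family_def by blast
    then have "norm (u - v) \<le> M * norm (?p - ?q)"
      using norm_ge_M[of "h i" "u - v"] by (simp add: matrix_vector_mult_diff_distrib)
    then have "(norm (u - v))\<^sup>2 \<le> (M * norm (?p - ?q))\<^sup>2"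
      by (rule power_mono) simp
    then have "(norm (u - v))\<^sup>2 \<le> M\<^sup>2 * (norm (?p - ?q))\<^sup>2"
      by (simp add: power_mult_distrib)
    then have low: "m * (norm (u - v))\<^sup>2 \<le> (norm (?p - ?q))\<^sup>2 / 4"
      using M_ge_1 by (simp add: m_def field_simps)
    have "(norm ((1/2) *\<^sub>R (?p + ?q)))\<^sup>2 = ((norm ?p)\<^sup>2 + (norm ?q)\<^sup>2) / 2 - (norm (?p - ?q))\<^sup>2 / 4"
      by (rule norm_half_sum_square)
    then show "(norm (h i *v midpoint u v - a i))\<^sup>2 - b i \<le>
      (sup_form I h a b u + sup_form I h a b v) / 2 - m * (norm (u - v))\<^sup>2"
      using low sup_form_ge[OF assms i, of u] sup_form_ge[OF assms i, of v] unfolding mid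
      by argo
  qed
  then show ?thesis using m unfolding strongly_midconvex_def by blast
qed

text \<open>On every ball all terms share one Lipschitz constant, which the supremum
  inherits.\<close>

lemma continuous_on_sup_form:
  assumes "bounded_family I h a b"
  shows "continuous_on UNIV (sup_form I h a b)"
proof -
  obtain r where r: "r > 0" "\<And>i v. i \<in> I \<Longrightarrow> norm (h i *v v - a i) \<le> M * norm v + r"
    using bounded_family_norm_le[OF assms] by blast
  have ne: "I \<noteq> {}" using assms unfolding bounded_family_def by blast
  have lip: "sup_form I h a b u \<le> sup_form I h a b v + 2 * (M * R + r) * (M * norm (u - v))"
    if "norm u \<le> R" "norm v \<le> R" for u v R
    unfolding sup_form_def
  proof (rule cSUP_le_cSUP_plus[OF ne bdd_above_sup_form[OF assms]], rule bexI)
    fix i assume i: "i \<in> I"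
    have R: "M * norm u \<le> M * R" "M * norm v \<le> M * R" "0 \<le> M * R"
      using that M_ge_1 order_trans[OF norm_ge_zero that(1)] by (auto intro: mult_left_mono)
    have "\<bar>(norm (h i *v u - a i))\<^sup>2 - (norm (h i *v v - a i))\<^sup>2\<bar> \<le>
        2 * (M * R + r) * norm ((h i *v u - a i) - (h i *v v - a i))"
      using r(2)[OF i, of u] r(2)[OF i, of v] R by (intro abs_norm_square_diff_le) auto
    also have "\<dots> \<le> 2 * (M * R + r) * (M * norm (u - v))"
      using norm_le_M[of "h i" "u - v"] assms i r(1) R unfolding bounded_family_def
      by (intro mult_left_mono) (auto simp: matrix_vector_mult_diff_distrib)
    finally show "(norm (h i *v u - a i))\<^sup>2 - b i \<le>
        (norm (h i *v v - a i))\<^sup>2 - b i + 2 * (M * R + r) * (M * norm (u - v))" by linarith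
  qed
  have "(sup_form I h a b \<longlongrightarrow> sup_form I h a b v) (at v)" for v
  proof -
    \<comment> \<open>Lipschitz constant on the ball of radius \<open>norm v + 1\<close>, which
      contains the unit neighbourhood of \<open>v\<close>.\<close>
    define C where "C = 2 * (M * (norm v + 1) + r) * M"
    have "norm (sup_form I h a b u - sup_form I h a b v) \<le> norm (u - v) * C" if "dist u v < 1" for u
    proof -
      have "norm u \<le> norm v + 1" using norm_triangle_ineq2[of u v] that by (simp add: dist_norm)
      then show ?thesis using lip[of u "norm v + 1" v] lip[of v "norm v + 1" u]
        by (simp add: C_def abs_le_iff norm_minus_commute[of u v] mult_ac)
    qed
    then have "eventually (\<lambda>u. norm (sup_form I h a b u - sup_form I h a b v) \<le> norm (u - v) * C) (at v)"
      unfolding eventually_at by (intro exI[of _ 1]) auto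
    from tendsto_0_le[OF LIM_zero[OF tendsto_ident_at] this] show ?thesis
      by (rule LIM_zero_cancel)
  qed
  then show ?thesis by (simp add: continuous_on_def)
qed

lemma is_minimizer_sup_form:
  assumes "bounded_family I h a b" "mat 1 \<in> h ` I" "closed S" "convex S" "S \<noteq> {}"
  shows "is_minimizer (sup_form I h a b) S (minimizer (sup_form I h a b) S)"
proof -
  obtain i where i: "i \<in> I" "h i = mat 1" using assms(2) by force
  show ?thesis
    by (rule is_minimizer_minimizer[OF assms(3-5) continuous_on_sup_form[OF assms(1)]
          strongly_midconvex_sup_form[OF assms(1)] sup_form_coercive[OF assms(1) i]])
qed

subsection \<open>An equivariant center\<close>

lemma bij_mem: "A \<in> G \<Longrightarrow> bij ((*v) A)"
  using invertible_mem invertible_eq_bij by blast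

lemma affine_image_mem:
  assumes "A \<in> G" "K \<in> convex_bodies" shows "(\<lambda>x. t + A *v x) ` K \<in> convex_bodies"
  using convex_body_translation[OF image_mem[OF assms], of "- t"]
  by (simp add: image_image add.commute)

text \<open>This is the supremum of \<open>|h (v - x)|\<^sup>2\<close>, with \<open>h\<close>
  distributed over the difference to fit \<open>sup_form\<close>.\<close>

definition spread :: "(real^'n) set \<Rightarrow> real^'n \<Rightarrow> real" where
  "spread K = sup_form (G \<times> K) fst (\<lambda>(h, x). h *v x) (\<lambda>_. 0)"

text \<open>The value at \<open>K\<close> is a Chebyshev center of \<open>K\<close> for the \<open>G\<close>-invariant norm \<open>sup {|h v| | h \<in> G}\<close>.\<close>

definition center :: "(real^'n) set \<Rightarrow> real^'n" where
  "center K = minimizer (spread K) UNIV"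

lemma bounded_family_spread:
  assumes "K \<in> convex_bodies"
  shows "bounded_family (G \<times> K) fst (\<lambda>(h, x). h *v x) (\<lambda>_. 0)"
proof -
  obtain r where r: "\<And>x. x \<in> K \<Longrightarrow> norm x \<le> r"
    using convex_bodyD(4)[OF assms] unfolding bounded_iff by blast
  have "norm (h *v x) \<le> M * r" if "h \<in> G" "x \<in> K" for h x
  proof -
    have "M * norm x \<le> M * r" using r[OF that(2)] M_ge_1 by (intro mult_left_mono) auto
    then show ?thesis using norm_le_M[OF that(1), of x] by linarith
  qed
  then have "bounded ((\<lambda>(h, x). h *v x) ` (G \<times> K))"
    by (intro boundedI[of _ "M * r"]) auto
  then show ?thesis using one_mem convex_bodyD(5)[OF assms] unfolding bounded_family_def by auto
qed

lemma mat_1_mem_fst_image: "X \<noteq> {} \<Longrightarrow> mat 1 \<in> fst ` (G \<times> X)"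
  using one_mem by auto

lemma is_minimizer_center:
  "K \<in> convex_bodies \<Longrightarrow> is_minimizer (spread K) UNIV (center K)"
  unfolding center_def spread_def
  by (intro is_minimizer_sup_form bounded_family_spread mat_1_mem_fst_image) (auto simp: convex_bodyD)

text \<open>The shift cancels in \<open>h (t + A v) - h (t + A x)\<close>, and \<open>A\<close> is
  absorbed by the reindexing \<open>h \<mapsto> h A\<close> of \<open>G\<close>; both suprema run
  over the same set of values.\<close>

lemma spread_affine_image:
  assumes A: "A \<in> G"
  shows "spread ((\<lambda>x. t + A *v x) ` K) (t + A *v v) = spread K v"
proof -
  have eq: "h *v (t + A *v v) - h *v (t + A *v x) = (h ** A) *v v - (h ** A) *v x" for h x
    by (simp add: matrix_vector_right_distrib matrix_vector_mul_assoc)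
  have "(\<lambda>i. (norm (fst i *v (t + A *v v) - (case i of (h, x) \<Rightarrow> h *v x)))\<^sup>2 - 0) ` (G \<times> (\<lambda>x. t + A *v x) ` K)
      = (\<lambda>i. (norm (fst i *v v - (case i of (h, x) \<Rightarrow> h *v x)))\<^sup>2 - 0) ` (G \<times> K)" (is "?F ` _ = ?f ` _")
  proof (intro subset_antisym subsetI)
    fix y assume "y \<in> ?F ` (G \<times> (\<lambda>x. t + A *v x) ` K)"
    then obtain h x where hx: "h \<in> G" "x \<in> K" "y = ?F (h, t + A *v x)" by auto
    then have "y = ?f (h ** A, x)" by (simp add: eq)
    then show "y \<in> ?f ` (G \<times> K)" using hx mult_mem[OF _ A] by blast
  next
    fix y assume "y \<in> ?f ` (G \<times> K)"
    then obtain h x where hx: "h \<in> G" "x \<in> K" "y = ?f (h, x)" by auto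
    obtain h' where h': "h' \<in> G" "h = h' ** A" using mem_right_translate[OF A hx(1)] .
    then have "y = ?F (h', t + A *v x)" using hx(3) by (simp add: eq)
    then show "y \<in> ?F ` (G \<times> (\<lambda>x. t + A *v x) ` K)" using h' hx by blast
  qed
  then show ?thesis unfolding spread_def sup_form_def by (rule arg_cong[where f = Sup])
qed

text \<open>An affine bijection carries the minimizer of one objective to a minimizer of the other
  over the whole space, and uniqueness identifies it.\<close>

lemma center_affine_image:
  assumes "A \<in> G" "K \<in> convex_bodies"
  shows "center ((\<lambda>x. t + A *v x) ` K) = t + A *v center K"
proof -
  have "surj ((+) t \<circ> (*v) A)"
    by (intro comp_surj bij_is_surj[OF bij_mem[OF assms(1)]] surj_plus)
  then have surj: "range (\<lambda>x. t + A *v x) = UNIV" by (simp add: comp_def)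
  have "is_minimizer (spread ((\<lambda>x. t + A *v x) ` K)) (range (\<lambda>x. t + A *v x)) (t + A *v center K)"
    by (rule is_minimizer_image[where f = "spread K"])
      (simp_all add: spread_affine_image is_minimizer_center assms)
  then have "is_minimizer (spread ((\<lambda>x. t + A *v x) ` K)) UNIV (t + A *v center K)"
    by (simp add: surj)
  moreover have "strongly_midconvex (spread ((\<lambda>x. t + A *v x) ` K))"
    unfolding spread_def
    by (intro strongly_midconvex_sup_form bounded_family_spread affine_image_mem assms)
  ultimately show ?thesis unfolding center_def by (intro minimizer_eqI) auto
qed

text \<open>Each \<open>x\<close> in \<open>L\<close> is replaced by a nearby \<open>y\<close> in
  \<open>K\<close> under the same \<open>h\<close>: the difference vectors move by at most
  \<open>M * \<delta>\<close> and have norm at most \<open>M * (R + r)\<close>. Exchanging the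
  bodies gives the reverse estimate.\<close>

lemma spread_le_spread_plus:
  assumes "K \<in> convex_bodies" "L \<in> convex_bodies" "norm v \<le> R"
    and "\<And>x. x \<in> K \<Longrightarrow> norm x \<le> r" "\<And>x. x \<in> L \<Longrightarrow> norm x \<le> r"
    and "\<And>x. x \<in> L \<Longrightarrow> \<exists>y\<in>K. dist x y \<le> \<delta>"
  shows "spread L v \<le> spread K v + 2 * (M * (R + r)) * (M * \<delta>)"
  unfolding spread_def sup_form_def
proof (rule cSUP_le_cSUP_plus)
  show "G \<times> L \<noteq> {}" using one_mem convex_bodyD(5)[OF assms(2)] by blast
  show "bdd_above ((\<lambda>i. (norm (fst i *v v - (case i of (h, x) \<Rightarrow> h *v x)))\<^sup>2 - 0) ` (G \<times> K))"
    by (rule bdd_above_sup_form[OF bounded_family_spread[OF assms(1)]])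
  fix i assume "i \<in> G \<times> L"
  then obtain h x where i: "i = (h, x)" "h \<in> G" "x \<in> L" by blast
  obtain y where y: "y \<in> K" "dist x y \<le> \<delta>" using assms(6)[OF i(3)] by blast
  have bound: "norm (h *v v - h *v z) \<le> M * (R + r)" if "norm z \<le> r" for z
  proof -
    have "norm (h *v v - h *v z) \<le> M * norm (v - z)"
      using norm_le_M[OF i(2), of "v - z"] by (simp add: matrix_vector_mult_diff_distrib)
    also have "\<dots> \<le> M * (R + r)"
      using norm_triangle_ineq4[of v z] that assms(3) M_ge_1 by (intro mult_left_mono) auto
    finally show ?thesis .
  qed
  have pos: "0 \<le> M * (R + r)" using order_trans[OF norm_ge_zero bound[OF assms(5)[OF i(3)]]] .
  have "\<bar>(norm (h *v v - h *v x))\<^sup>2 - (norm (h *v v - h *v y))\<^sup>2\<bar>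
      \<le> 2 * (M * (R + r)) * norm ((h *v v - h *v x) - (h *v v - h *v y))"
    by (intro abs_norm_square_diff_le bound assms i y)
  also have "\<dots> \<le> 2 * (M * (R + r)) * (M * \<delta>)"
  proof (rule mult_left_mono)
    have "norm ((h *v v - h *v x) - (h *v v - h *v y)) = norm (h *v (y - x))"
      by (simp add: matrix_vector_mult_diff_distrib)
    also have "\<dots> \<le> M * norm (y - x)" by (rule norm_le_M[OF i(2)])
    also have "\<dots> \<le> M * \<delta>"
      using y(2) M_ge_1 by (intro mult_left_mono) (auto simp: dist_norm norm_minus_commute)
    finally show "norm ((h *v v - h *v x) - (h *v v - h *v y)) \<le> M * \<delta>" .
  qed (use pos in simp)
  finally show "\<exists>j\<in>G \<times> K. (norm (fst i *v v - (case i of (h, x) \<Rightarrow> h *v x)))\<^sup>2 - 0 \<le>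
      (norm (fst j *v v - (case j of (h, x) \<Rightarrow> h *v x)))\<^sup>2 - 0 + 2 * (M * (R + r)) * (M * \<delta>)"
    using i y by (intro bexI[of _ "(h, y)"]) auto
qed

text \<open>Bodies close to \<open>K\<close> lie in one ball of radius \<open>r + 1\<close>, so
  their objectives are uniformly close to that of \<open>K\<close> on bounded sets and share a
  coercivity constant; this is what stability of minimizers requires.\<close>

lemma tendsto_center:
  assumes K: "K \<in> convex_bodies"
  shows "(center \<longlongrightarrow> center K) (atin hausdorff_topology K)"
proof -
  obtain r where r: "r > 0" "\<And>x. x \<in> K \<Longrightarrow> norm x \<le> r"
    using convex_bodyD(4)[OF K] unfolding bounded_pos by blast
  have bounded: "eventually (\<lambda>L. L \<in> convex_bodies \<and> (\<forall>x\<in>L. norm x \<le> r + 1)) (atin hausdorff_topology K)"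
    using eventually_bodies_close[OF K zero_less_one]
  proof eventually_elim
    case (elim L)
    have "norm x \<le> r + 1" if "x \<in> L" for x
    proof -
      from elim that have "\<exists>z\<in>K. dist x z \<le> 1" by simp
      then obtain z where z: "z \<in> K" "dist x z \<le> 1" by blast
      then show ?thesis using r(2)[OF z(1)] norm_triangle_ineq2[of x z] by (simp add: dist_norm)
    qed
    then show ?case using elim by simp
  qed
  have min: "eventually (\<lambda>L. is_minimizer (spread L) UNIV (center L)) (atin hausdorff_topology K)"
    using bounded by eventually_elim (simp add: is_minimizer_center)
  have close: "eventually (\<lambda>L. \<forall>v. norm v \<le> R \<longrightarrow> \<bar>spread L v - spread K v\<bar> \<le> e) (atin hausdorff_topology K)"
    if e: "e > 0" for R e
  proof -
    \<comment> \<open>The factor of \<open>\<delta>\<close> in \<open>spread_le_spread_plus\<close>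
      for the radius \<open>r + 1\<close>; the absolute value covers negative
      \<open>R\<close>.\<close>
    define C where "C = 2 * (M * (\<bar>R\<bar> + (r + 1))) * M"
    have "C > 0" using r(1) M_ge_1 unfolding C_def by (intro mult_pos_pos) auto
    then have \<delta>: "e / C > 0" "C * (e / C) = e" using e by auto
    show ?thesis using bounded eventually_bodies_close[OF K \<delta>(1)]
    proof eventually_elim
      case (elim L)
      have "\<bar>spread L v - spread K v\<bar> \<le> e" if "norm v \<le> R" for v
      proof -
        have v: "norm v \<le> \<bar>R\<bar>" using that by linarith
        have rK: "norm x \<le> r + 1" if "x \<in> K" for x using r(2)[OF that] by linarith
        have "spread L v \<le> spread K v + 2 * (M * (\<bar>R\<bar> + (r + 1))) * (M * (e / C))"
          using elim v rK by (intro spread_le_spread_plus K) auto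
        moreover have "spread K v \<le> spread L v + 2 * (M * (\<bar>R\<bar> + (r + 1))) * (M * (e / C))"
          using elim v rK by (intro spread_le_spread_plus K) auto
        moreover have "2 * (M * (\<bar>R\<bar> + (r + 1))) * (M * t) = C * t" for t
          by (simp only: C_def mult.assoc)
        then have "2 * (M * (\<bar>R\<bar> + (r + 1))) * (M * (e / C)) = e" using \<delta>(2) by presburger
        ultimately show ?thesis by linarith
      qed
      then show ?case by blast
    qed
  qed
  \<comment> \<open>Here \<open>r + 2\<close> is the bound \<open>r + 1\<close> for a point of
    \<open>L\<close> plus the 1 of \<open>sup_form_coercive\<close>; the penalty is 0.\<close>
  have coercive: "eventually (\<lambda>L. \<forall>v. norm v - (r + 2) \<le> spread L v) (atin hausdorff_topology K)"
    using bounded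
  proof eventually_elim
    case (elim L)
    then obtain x where x: "x \<in> L" "norm x \<le> r + 1" using convex_bodyD(5)[of L] by blast
    have "norm v - (r + 2) \<le> spread L v" for v
      using sup_form_coercive[OF bounded_family_spread, of L "(mat 1, x)" v] elim x one_mem
      unfolding spread_def by auto
    then show ?case by blast
  qed
  have univ: "eventually (\<lambda>L. (\<forall>y\<in>UNIV. \<exists>z\<in>UNIV. dist y z \<le> e) \<and> (\<forall>z\<in>UNIV. \<exists>y\<in>UNIV. dist z y \<le> e))
      (atin hausdorff_topology K)" if "e > 0" for e :: real
    using that by (intro always_eventually) (metis dist_self less_imp_le)
  show ?thesis
    using continuous_on_sup_form[OF bounded_family_spread[OF K]]
      strongly_midconvex_sup_form[OF bounded_family_spread[OF K]] is_minimizer_center[OF K]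
      min close coercive univ
    unfolding spread_def[symmetric]
    by (rule tendsto_minimizer[OF _ _ convex_UNIV])
qed

subsection \<open>Equivariant selection\<close>

text \<open>Subtracting the equivariant center removes the shifts: affine maps act on normalized
  bodies through their matrices alone.\<close>

definition normalized :: "(real^'n) set \<Rightarrow> (real^'n) set" where
  "normalized K = (\<lambda>x. x - center K) ` K"

lemma normalized_mem: "K \<in> convex_bodies \<Longrightarrow> normalized K \<in> convex_bodies"
  unfolding normalized_def by (rule convex_body_translation)

lemma normalized_affine_image:
  assumes "A \<in> G" "K \<in> convex_bodies"
  shows "normalized ((\<lambda>x. t + A *v x) ` K) = (*v) A ` normalized K"
  unfolding normalized_def center_affine_image[OF assms]
  by (simp add: image_image matrix_vector_mult_diff_distrib)

lemma eventually_normalized_near: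
  assumes "K \<in> convex_bodies" "e > 0"
  shows "eventually (\<lambda>L. L \<in> convex_bodies \<and> hausdorff_dist (normalized L) (normalized K) < e)
           (atin hausdorff_topology K)"
proof -
  have "e/2 > 0" using assms(2) by simp
  from eventually_near_body[OF this] tendstoD[OF tendsto_center[OF assms(1)] this]
  show ?thesis
  proof eventually_elim
    case (elim L)
    then show ?case
      using hausdorff_dist_translation_le[of L K "center L" "center K"] assms(1)
      unfolding normalized_def by auto
  qed
qed

text \<open>For each pair, \<open>g *v v0\<close> is a target for \<open>h *v v\<close>, discounted
  by the distance between \<open>K\<close> moved by \<open>h\<close> and the reference body
  \<open>K1\<close> moved by \<open>g\<close>. The body \<open>K\<close> enters only through this
  penalty.\<close>

definition penalized :: "(real \<Rightarrow> real) \<Rightarrow> (real^'n) set \<Rightarrow> real^'n \<Rightarrow> (real^'n) set \<Rightarrow> real^'n \<Rightarrow> real" where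
  "penalized \<omega> K1 v0 K =
     sup_form (G \<times> G) fst (\<lambda>(h, g). g *v v0) (\<lambda>i. \<omega> (orbit_dist K K1 i))"

lemma bounded_family_penalized:
  assumes "is_modulus \<omega>"
  shows "bounded_family (G \<times> G) fst (\<lambda>(h, g). g *v v0) (\<lambda>i. \<omega> (orbit_dist K K1 i))"
proof -
  have "bounded ((\<lambda>(h, g). g *v v0) ` (G \<times> G))"
    using norm_le_M by (intro boundedI[of _ "M * norm v0"]) auto
  then show ?thesis using one_mem is_modulusD(2)[OF assms orbit_dist_nonneg]
    unfolding bounded_family_def by auto
qed

text \<open>Reindexing \<open>h \<mapsto> h A\<close> in the first component; the second, which acts
  on the reference data \<open>K1\<close> and \<open>v0\<close>, stays put.\<close>

lemma penalized_linear_image: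
  assumes A: "A \<in> G"
  shows "penalized \<omega> K1 v0 ((*v) A ` K) (A *v v) = penalized \<omega> K1 v0 K v"
proof -
  have dist: "orbit_dist ((*v) A ` K) K1 (h, g) = orbit_dist K K1 (h ** A, g)" for h g
    by (simp add: orbit_dist_def image_image matrix_vector_mul_assoc)
  let ?F = "\<lambda>i. (norm (fst i *v (A *v v) - (case i of (h, g) \<Rightarrow> g *v v0)))\<^sup>2 - \<omega> (orbit_dist ((*v) A ` K) K1 i)"
  let ?f = "\<lambda>i. (norm (fst i *v v - (case i of (h, g) \<Rightarrow> g *v v0)))\<^sup>2 - \<omega> (orbit_dist K K1 i)"
  have eq: "?F (h, g) = ?f (h ** A, g)" for h g
    by (simp add: dist matrix_vector_mul_assoc)
  have "?F ` (G \<times> G) = ?f ` (G \<times> G)"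
  proof (intro subset_antisym subsetI)
    fix y assume "y \<in> ?F ` (G \<times> G)"
    then obtain h g where hg: "h \<in> G" "g \<in> G" "y = ?F (h, g)" by auto
    then have "y = ?f (h ** A, g)" by (simp only: eq)
    then show "y \<in> ?f ` (G \<times> G)" using hg mult_mem[OF _ A] by blast
  next
    fix y assume "y \<in> ?f ` (G \<times> G)"
    then obtain h g where hg: "h \<in> G" "g \<in> G" "y = ?f (h, g)" by auto
    obtain h' where h': "h' \<in> G" "h = h' ** A" using mem_right_translate[OF A hg(1)] .
    then have "y = ?F (h', g)" using hg(3) by (simp only: eq)
    then show "y \<in> ?F ` (G \<times> G)" using h' hg by blast
  qed
  then show ?thesis unfolding penalized_def sup_form_def by (rule arg_cong[where f = Sup])
qed

text \<open>The bound does not depend on \<open>i\<close>, which makes the objectives of nearby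
  bodies uniformly close.\<close>

lemma orbit_dist_diff_le:
  assumes "K \<in> convex_bodies" "L \<in> convex_bodies" "K1 \<in> convex_bodies" "i \<in> G \<times> G"
  shows "\<bar>orbit_dist L K1 i - orbit_dist K K1 i\<bar> \<le> M * hausdorff_dist L K"
proof -
  obtain h g where i: "i = (h, g)" "h \<in> G" "g \<in> G" using assms(4) by blast
  have "\<bar>orbit_dist L K1 i - orbit_dist K K1 i\<bar> \<le>
      hausdorff_dist ((*v) h ` L) ((*v) h ` K) + hausdorff_dist ((*v) g ` K1) ((*v) g ` K1)"
    unfolding orbit_dist_def i(1) prod.case
    by (intro abs_hausdorff_dist_diff_le image_mem i assms)
  also have "hausdorff_dist ((*v) g ` K1) ((*v) g ` K1) = 0"
    using hausdorff_dist_eq_0 image_mem[OF i(3) assms(3)] by blast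
  finally show ?thesis using hausdorff_dist_linear_image_le[OF i(2) assms(2,1)] by linarith
qed

text \<open>Distance 0 means that \<open>h\<close> and \<open>g\<close> send \<open>K1\<close> to
  the same body, so the inverse of \<open>g\<close> times \<open>h\<close> stabilizes
  \<open>K1\<close> and fixes \<open>v0\<close>, whence \<open>h *v v0 = g *v v0\<close>.
  Compactness of \<open>G \<times> G\<close> upgrades this implication to a modulus.\<close>

lemma stabilizer_modulus:
  assumes K1: "K1 \<in> convex_bodies"
    and fixed: "\<forall>A\<in>G. (*v) A ` K1 = K1 \<longrightarrow> A *v v0 = v0"
  obtains \<omega> where "is_modulus \<omega>"
    "\<And>h g. h \<in> G \<Longrightarrow> g \<in> G \<Longrightarrow> (norm (h *v v0 - g *v v0))\<^sup>2 \<le> \<omega> (orbit_dist K1 K1 (h, g))"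
proof -
  let ?f = "\<lambda>i. (norm (fst i *v v0 - snd i *v v0))\<^sup>2"
  have eq0: "?f i \<le> 0" if i: "i \<in> G \<times> G" and "orbit_dist K1 K1 i = 0" for i
  proof -
    obtain h g where hg: "i = (h, g)" "h \<in> G" "g \<in> G" using i by blast
    have "(*v) h ` K1 = (*v) g ` K1"
      using that(2) hausdorff_dist_eq_0[OF image_mem[OF hg(2) K1] image_mem[OF hg(3) K1]]
      by (simp add: orbit_dist_def hg)
    moreover obtain g' where g': "g' \<in> G" "g ** g' = mat 1" "g' ** g = mat 1"
      using inv_mem[OF hg(3)] by blast
    ultimately have "(*v) g' ` (*v) h ` K1 = (*v) g' ` (*v) g ` K1" by simp
    then have "(*v) (g' ** h) ` K1 = K1"
      using g' by (simp add: image_image matrix_vector_mul_assoc)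
    then have "(g' ** h) *v v0 = v0" using fixed mult_mem[OF g'(1) hg(2)] by blast
    then have "g *v ((g' ** h) *v v0) = g *v v0" by simp
    then have "h *v v0 = g *v v0" using g' by (simp add: matrix_vector_mul_assoc matrix_mul_assoc)
    then show ?thesis by (simp add: hg)
  qed
  have bil: "continuous_on UNIV (\<lambda>A::real^'n^'n. A *v v0)"
  proof (intro linear_continuous_on bounded_linear_intro)
    show "norm (A *v v0) \<le> norm A * (real CARD('n) * norm v0)" for A :: "real^'n^'n"
      using norm_matrix_vector_mult_le[of A v0] by (simp add: mult_ac)
  qed (simp_all add: matrix_vector_mult_add_rdistrib scaleR_matrix_vector_assoc)
  have cont: "continuous_on (G \<times> G) ?f"
    by (intro continuous_intros continuous_on_compose2[OF bil]) auto
  have affine: "\<exists>b\<ge>0. \<forall>i\<in>G \<times> G. ?f i \<le> e + b * orbit_dist K1 K1 i" if "e > 0" for e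
    using compact_affine_bound[OF compact_Times[OF compact_G compact_G] cont
        continuous_on_orbit_dist[OF K1] orbit_dist_nonneg eq0 that] .
  obtain \<omega> where \<omega>: "is_modulus \<omega>" "\<forall>i\<in>G \<times> G. ?f i \<le> \<omega> (orbit_dist K1 K1 i)"
    using subadditive_modulus_exists[of "G \<times> G" "orbit_dist K1 K1" ?f] orbit_dist_nonneg affine
    by blast
  have "(norm (h *v v0 - g *v v0))\<^sup>2 \<le> \<omega> (orbit_dist K1 K1 (h, g))" if "h \<in> G" "g \<in> G" for h g
    using \<omega>(2)[rule_format, of "(h, g)"] that by simp
  with \<omega>(1) show ?thesis by (rule that)
qed

text \<open>The displacement from the center is sought in the feasible set \<open>T K\<close>;
  keeping \<open>T\<close> abstract covers both \<open>normalized\<close> and the whole space. Its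
  equivariance law has no \<open>t\<close> on the right, since displacements ignore shifts.\<close>

lemma invariant_selection_exists:
  fixes T :: "(real^'n) set \<Rightarrow> (real^'n) set"
  assumes K0: "K0 \<in> convex_bodies"
    and fixed: "\<And>A. A \<in> G \<Longrightarrow> (*v) A ` normalized K0 = normalized K0 \<Longrightarrow>
                  A *v (x0 - center K0) = x0 - center K0"
    and T: "\<And>K. K \<in> convex_bodies \<Longrightarrow> closed (T K) \<and> convex (T K) \<and> T K \<noteq> {}"
    and T_image: "\<And>K A t. K \<in> convex_bodies \<Longrightarrow> A \<in> G \<Longrightarrow> T ((\<lambda>x. t + A *v x) ` K) = (*v) A ` T K"
    and T_near: "\<And>K e. K \<in> convex_bodies \<Longrightarrow> e > 0 \<Longrightarrow>
      eventually (\<lambda>L. (\<forall>y\<in>T L. \<exists>z\<in>T K. dist y z \<le> e) \<and> (\<forall>z\<in>T K. \<exists>y\<in>T L. dist z y \<le> e))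
        (atin hausdorff_topology K)"
    and x0: "x0 - center K0 \<in> T K0"
  obtains p where "continuous_map hausdorff_topology euclidean p"
    "\<And>K A t. K \<in> convex_bodies \<Longrightarrow> A \<in> G \<Longrightarrow> p ((\<lambda>x. t + A *v x) ` K) = t + A *v p K"
    "p K0 = x0" "\<And>K. K \<in> convex_bodies \<Longrightarrow> p K - center K \<in> T K"
proof -
  define K1 where "K1 = normalized K0"
  define v0 where "v0 = x0 - center K0"
  have K1: "K1 \<in> convex_bodies" unfolding K1_def by (rule normalized_mem[OF K0])
  have fixed1: "\<forall>A\<in>G. (*v) A ` K1 = K1 \<longrightarrow> A *v v0 = v0"
    using fixed unfolding K1_def v0_def by blast
  obtain \<omega> where \<omega>: "is_modulus \<omega>"
    "\<And>h g. h \<in> G \<Longrightarrow> g \<in> G \<Longrightarrow> (norm (h *v v0 - g *v v0))\<^sup>2 \<le> \<omega> (orbit_dist K1 K1 (h, g))"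
    using stabilizer_modulus[OF K1 fixed1] by blast
  define F where "F K = penalized \<omega> K1 v0 (normalized K)" for K
  define q where "q K = minimizer (F K) (T K)" for K
  define p where "p K = center K + q K" for K
  note family = bounded_family_penalized[OF \<omega>(1)]
  have F_convex: "strongly_midconvex (F K)" for K
    unfolding F_def penalized_def by (rule strongly_midconvex_sup_form[OF family])
  have F_cont: "continuous_on UNIV (F K)" for K
    unfolding F_def penalized_def by (rule continuous_on_sup_form[OF family])
  have q_min: "is_minimizer (F K) (T K) (q K)" if "K \<in> convex_bodies" for K
    unfolding q_def F_def penalized_def
    using T[OF that] one_mem by (intro is_minimizer_sup_form family mat_1_mem_fst_image) auto
  have q_image: "q ((\<lambda>x. t + A *v x) ` K) = A *v q K" if "K \<in> convex_bodies" "A \<in> G" for K A t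
  proof -
    have body: "(\<lambda>x. t + A *v x) ` K \<in> convex_bodies" using that by (intro affine_image_mem)
    have "F ((\<lambda>x. t + A *v x) ` K) (A *v v) = F K v" for v
      unfolding F_def using that by (simp add: normalized_affine_image penalized_linear_image)
    from is_minimizer_image[where \<phi> = "(*v) A", OF this q_min[OF that(1)]]
    have "is_minimizer (F ((\<lambda>x. t + A *v x) ` K)) (T ((\<lambda>x. t + A *v x) ` K)) (A *v q K)"
      by (simp add: T_image that)
    moreover have "convex (T ((\<lambda>x. t + A *v x) ` K))" using T[OF body] by blast
    ultimately show ?thesis unfolding q_def[of "(\<lambda>x. t + A *v x) ` K"]
      by (intro minimizer_eqI F_convex)
  qed
  have q_lim: "(q \<longlongrightarrow> q K) (atin hausdorff_topology K)" if K: "K \<in> convex_bodies" for K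
  proof -
    have near: "eventually (\<lambda>L. L \<in> convex_bodies \<and>
        (\<forall>i\<in>G \<times> G. \<bar>\<omega> (orbit_dist (normalized L) K1 i) - \<omega> (orbit_dist (normalized K) K1 i)\<bar> \<le> e))
      (atin hausdorff_topology K)" if e: "e > 0" for e
    proof -
      obtain d where d: "d > 0" "\<And>t. 0 \<le> t \<Longrightarrow> t \<le> d \<Longrightarrow> \<omega> t < e" using is_modulusD(4)[OF \<omega>(1) e] by blast
      \<comment> \<open>\<open>orbit_dist_diff_le\<close> loses a factor \<open>M\<close>.\<close>
      have "d / M > 0" using d(1) M_ge_1 by simp
      from eventually_normalized_near[OF K this] show ?thesis
      proof eventually_elim
        case (elim L)
        have "\<bar>\<omega> (orbit_dist (normalized L) K1 i) - \<omega> (orbit_dist (normalized K) K1 i)\<bar> \<le> e"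
          if i: "i \<in> G \<times> G" for i
        proof -
          have "M * hausdorff_dist (normalized L) (normalized K) \<le> d"
            using elim M_ge_1 by (simp add: field_simps)
          then have "\<bar>orbit_dist (normalized L) K1 i - orbit_dist (normalized K) K1 i\<bar> \<le> d"
            using orbit_dist_diff_le[of "normalized K" "normalized L" K1 i] normalized_mem K K1 elim i
            by force
          then show ?thesis
            using d(2)[OF abs_ge_zero]
              is_modulusD(3)[OF \<omega>(1) orbit_dist_nonneg orbit_dist_nonneg, of "normalized L" K1 i]
            by (meson less_imp_le order_trans)
        qed
        then show ?case using elim by blast
      qed
    qed
    have F_le: "F L v \<le> F L' v + e"
      if "\<And>i. i \<in> G \<times> G \<Longrightarrow> \<bar>\<omega> (orbit_dist (normalized L) K1 i) - \<omega> (orbit_dist (normalized L') K1 i)\<bar> \<le> e"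
      for L L' v e
      unfolding F_def penalized_def sup_form_def
    proof (rule cSUP_le_cSUP_plus)
      show "G \<times> G \<noteq> {}" using one_mem by blast
      show "bdd_above ((\<lambda>i. (norm (fst i *v v - (case i of (h, g) \<Rightarrow> g *v v0)))\<^sup>2 -
          \<omega> (orbit_dist (normalized L') K1 i)) ` (G \<times> G))"
        by (rule bdd_above_sup_form[OF family])
      fix i assume i: "i \<in> G \<times> G"
      show "\<exists>j\<in>G \<times> G.
          (norm (fst i *v v - (case i of (h, g) \<Rightarrow> g *v v0)))\<^sup>2 - \<omega> (orbit_dist (normalized L) K1 i) \<le>
          (norm (fst j *v v - (case j of (h, g) \<Rightarrow> g *v v0)))\<^sup>2 - \<omega> (orbit_dist (normalized L') K1 j) + e"
        using that[OF i] by (intro bexI[OF _ i]) linarith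
    qed
    have close: "eventually (\<lambda>L. \<forall>v. norm v \<le> R \<longrightarrow> \<bar>F L v - F K v\<bar> \<le> e) (atin hausdorff_topology K)"
      if e: "e > 0" for R e
      using near[OF e]
    proof eventually_elim
      case (elim L)
      have "\<bar>F L v - F K v\<bar> \<le> e" for v
        using F_le[of L K e v] F_le[of K L e v] elim by (auto simp: abs_minus_commute abs_le_iff)
      then show ?case by blast
    qed
    \<comment> \<open>One more than the constant of \<open>sup_form_coercive\<close> for
      \<open>K\<close>: the spare 1 absorbs the change of the penalty at the identity pair.\<close>
    define b where "b = norm v0 + 2 + \<omega> (orbit_dist (normalized K) K1 (mat 1, mat 1))"
    have coercive: "eventually (\<lambda>L. \<forall>v. norm v - b \<le> F L v) (atin hausdorff_topology K)"
      using near[OF zero_less_one]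
    proof eventually_elim
      case (elim L)
      have "norm v - b \<le> F L v" for v
      proof -
        have i: "(mat 1, mat 1) \<in> G \<times> G" using one_mem by simp
        have "norm v - (norm v0 + 1 + \<omega> (orbit_dist (normalized L) K1 (mat 1, mat 1))) \<le> F L v"
          using sup_form_coercive[OF family i, of v v0 "normalized L" K1]
          unfolding F_def penalized_def by simp
        moreover have "\<bar>\<omega> (orbit_dist (normalized L) K1 (mat 1, mat 1)) -
            \<omega> (orbit_dist (normalized K) K1 (mat 1, mat 1))\<bar> \<le> 1"
          using elim i by blast
        ultimately show ?thesis unfolding b_def by linarith
      qed
      then show ?case by blast
    qed
    have min: "eventually (\<lambda>L. is_minimizer (F L) (T L) (q L)) (atin hausdorff_topology K)"
      using near[OF zero_less_one] by eventually_elim (simp add: q_min)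
    have "convex (T K)" using T[OF K] by blast
    from tendsto_minimizer[OF F_cont F_convex this q_min[OF K] min close coercive T_near[OF K]]
    show ?thesis .
  qed
  have "q K0 = v0"
  proof -
    \<comment> \<open>The identity pair has penalty \<open>\<omega> 0 = 0\<close> at
      \<open>K0\<close>, so it contributes the full square.\<close>
    have lower: "(norm (v - v0))\<^sup>2 \<le> F K0 v" for v
    proof -
      have "orbit_dist K1 K1 (mat 1, mat 1) = 0"
        using hausdorff_dist_eq_0[OF K1 K1] by (simp add: orbit_dist_def)
      then show ?thesis
        using sup_form_ge[OF family, of "(mat 1, mat 1)" v v0 K1 K1] one_mem is_modulusD(1)[OF \<omega>(1)]
        unfolding F_def penalized_def K1_def by simp
    qed
    \<comment> \<open>The modulus dominates every squared difference of images of \<open>v0\<close>,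
      so no pair contributes a positive term.\<close>
    have "F K0 v0 \<le> 0"
      unfolding F_def penalized_def sup_form_def
    proof (rule cSUP_least)
      show "G \<times> G \<noteq> {}" using one_mem by blast
      show "(norm (fst i *v v0 - (case i of (h, g) \<Rightarrow> g *v v0)))\<^sup>2 - \<omega> (orbit_dist (normalized K0) K1 i) \<le> 0"
        if "i \<in> G \<times> G" for i
        using that \<omega>(2) unfolding K1_def by auto
    qed
    then have "F K0 v0 \<le> F K0 v" for v
      using lower[of v] zero_le_power2[of "norm (v - v0)"] by linarith
    then have "is_minimizer (F K0) (T K0) v0"
      using x0 unfolding is_minimizer_def v0_def by blast
    then show ?thesis unfolding q_def using T[OF K0] by (intro minimizer_eqI F_convex) auto
  qed
  then have "p K0 = x0" unfolding p_def v0_def by simp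
  moreover have "continuous_map hausdorff_topology euclidean p"
    unfolding continuous_map_hausdorff_iff p_def by (intro ballI tendsto_add tendsto_center q_lim)
  moreover have "p ((\<lambda>x. t + A *v x) ` K) = t + A *v p K" if "K \<in> convex_bodies" "A \<in> G" for K A t
    unfolding p_def using that
    by (simp add: q_image center_affine_image matrix_vector_right_distrib)
  moreover have "p K - center K \<in> T K" if "K \<in> convex_bodies" for K
    using q_min[OF that] unfolding p_def is_minimizer_def by simp
  ultimately show ?thesis by (intro that[of p])
qed

section \<open>Passage from matrices to the affine group\<close>

text \<open>With \<open>c\<close> the center, the map \<open>y \<mapsto> c + A (y - c)\<close> is an
  automorphism of \<open>K\<close> in the affine group. It fixes \<open>x\<close>, which says that
  \<open>A\<close> fixes \<open>x - c\<close>.\<close>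

lemma linear_part_fixes:
  fixes K :: "(real^'n) set"
  assumes "subgroup G GL" "x \<in> fixed_points (body_automorphisms (affine_group G) K)"
    and A: "A \<in> G" "(*v) A ` normalized K = normalized K"
  shows "A *v (x - center K) = x - center K"
proof -
  let ?c = "center K" and ?\<phi> = "\<lambda>y. (center K - A *v center K) + A *v y"
  have \<phi>: "?\<phi> y = ?c + A *v (y - ?c)" for y
    by (simp add: matrix_vector_mult_diff_distrib)
  have "?\<phi> ` K = (+) ?c ` (*v) A ` normalized K"
    unfolding normalized_def image_image \<phi> ..
  also have "\<dots> = K" unfolding A(2) by (simp add: normalized_def image_image)
  finally have aut: "?\<phi> \<in> body_automorphisms (affine_group G) K"
    unfolding body_automorphisms_def using affine_mem_affine_group[OF assms(1) A(1)] by blast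
  have "\<forall>f\<in>body_automorphisms (affine_group G) K. f x = x"
    using assms(2) unfolding fixed_points_def by simp
  from bspec[OF this aut] have "?\<phi> x = x" .
  then show ?thesis unfolding \<phi> by (simp add: algebra_simps)
qed

lemma invariant_point_affine_group:
  assumes "subgroup G GL" "continuous_map hausdorff_topology euclidean p"
    and "\<And>K A t. K \<in> convex_bodies \<Longrightarrow> A \<in> G \<Longrightarrow> p ((\<lambda>x. t + A *v x) ` K) = t + A *v p K"
  shows "invariant_point (affine_group G) p"
  unfolding invariant_point_def using assms(2,3) affine_group_affine[OF assms(1)] by blast

text \<open>Minimizing over \<open>T = normalized\<close> keeps the displacement inside the
  normalized body, so \<open>p L\<close> lies in \<open>L\<close>; \<open>x \<in> K\<close> makes
  the desired displacement feasible.\<close>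

lemma invariant_point_of_body_exists:
  assumes G: "subgroup G GL" and K: "K \<in> convex_bodies" and x: "x \<in> K"
    and fixed: "x \<in> fixed_points (body_automorphisms (affine_group G) K)"
  shows "\<exists>p. invariant_point_of_body (affine_group G) p \<and> p K = x"
proof -
  obtain p where p: "continuous_map hausdorff_topology euclidean p"
    "\<And>K A t. K \<in> convex_bodies \<Longrightarrow> A \<in> G \<Longrightarrow> p ((\<lambda>x. t + A *v x) ` K) = t + A *v p K"
    "p K = x" "\<And>K. K \<in> convex_bodies \<Longrightarrow> p K - center K \<in> normalized K"
  proof (rule invariant_selection_exists[of K x normalized])
    show "A *v (x - center K) = x - center K" if "A \<in> G" "(*v) A ` normalized K = normalized K" for A
      by (rule linear_part_fixes[OF G fixed that])
    show "closed (normalized L) \<and> convex (normalized L) \<and> normalized L \<noteq> {}"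
      if "L \<in> convex_bodies" for L
      using convex_bodyD[OF normalized_mem[OF that]] by blast
    show "eventually (\<lambda>L'. (\<forall>y\<in>normalized L'. \<exists>z\<in>normalized L. dist y z \<le> e) \<and>
        (\<forall>z\<in>normalized L. \<exists>y\<in>normalized L'. dist z y \<le> e)) (atin hausdorff_topology L)"
      if L: "L \<in> convex_bodies" and e: "e > 0" for L e
      using eventually_normalized_near[OF L e]
    proof eventually_elim
      case (elim L')
      have n: "normalized L \<in> convex_bodies" "normalized L' \<in> convex_bodies"
        using L elim normalized_mem by auto
      have "\<exists>z\<in>normalized L. dist y z \<le> e" if "y \<in> normalized L'" for y
        using hausdorff_dist_attained[of "normalized L'" "normalized L" y] that elim n
        by (force simp: convex_bodyD)
      moreover have "\<exists>y\<in>normalized L'. dist z y \<le> e" if "z \<in> normalized L" for z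
        using hausdorff_dist_attained[of "normalized L" "normalized L'" z] that elim n
          hausdorff_dist_commute[of "normalized L" "normalized L'"]
        by (force simp: convex_bodyD)
      ultimately show ?case by blast
    qed
    show "x - center K \<in> normalized K" using x by (simp add: normalized_def)
  qed (use K normalized_affine_image in auto)
  have "p L \<in> L" if "L \<in> convex_bodies" for L
    using p(4)[OF that] by (auto simp: normalized_def)
  then show ?thesis
    using invariant_point_affine_group[OF G p(1,2)] p(3) unfolding invariant_point_of_body_def by blast
qed

text \<open>With \<open>T\<close> constantly the whole space every displacement is feasible, and
  equivariance of \<open>T\<close> is surjectivity of the matrices.\<close>

lemma invariant_point_exists:
  assumes G: "subgroup G GL" and K: "K \<in> convex_bodies"
    and fixed: "x \<in> fixed_points (body_automorphisms (affine_group G) K)"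
  shows "\<exists>p. invariant_point (affine_group G) p \<and> p K = x"
proof -
  obtain p where p: "continuous_map hausdorff_topology euclidean p"
    "\<And>K A t. K \<in> convex_bodies \<Longrightarrow> A \<in> G \<Longrightarrow> p ((\<lambda>x. t + A *v x) ` K) = t + A *v p K"
    "p K = x"
  proof (rule invariant_selection_exists[of K x "\<lambda>_. UNIV"])
    show "A *v (x - center K) = x - center K" if "A \<in> G" "(*v) A ` normalized K = normalized K" for A
      by (rule linear_part_fixes[OF G fixed that])
    show "UNIV = range ((*v) A)" if "A \<in> G" for A
      using bij_is_surj[OF bij_mem[OF that]] by simp
    show "eventually (\<lambda>L'. (\<forall>y\<in>UNIV. \<exists>z\<in>UNIV. dist y z \<le> e) \<and> (\<forall>z\<in>UNIV. \<exists>y\<in>UNIV. dist z y \<le> e))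
        (atin hausdorff_topology L)" if "e > 0" for L :: "(real^'n) set" and e
      using that by (intro always_eventually) (metis dist_self less_imp_le)
  qed (use K in auto)
  then show ?thesis using invariant_point_affine_group[OF G p(1,2)] by blast
qed

end

lemma compact_matrix_group_subgroup:
  fixes G :: "(real^'n^'n) set"
  assumes G: "subgroup G GL" and "compact G"
  shows "compact_matrix_group G"
proof
  show "mat 1 \<in> G" using subgroup.one_closed[OF G] by (simp add: GL_def)
  show "A ** B \<in> G" if "A \<in> G" "B \<in> G" for A B
    using subgroup.m_closed[OF G that] by (simp add: GL_def)
  show "\<exists>B\<in>G. A ** B = mat 1 \<and> B ** A = mat 1" if A: "A \<in> G" for A
  proof
    have AC: "A \<in> carrier GL" using subgroup.subset[OF G] A by blast
    show "inv\<^bsub>GL\<^esub> A \<in> G" by (rule subgroup.m_inv_closed[OF G A])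
    show "A ** inv\<^bsub>GL\<^esub> A = mat 1 \<and> inv\<^bsub>GL\<^esub> A ** A = mat 1"
      using group.l_inv[OF group_GL AC] group.r_inv[OF group_GL AC] by (simp add: GL_def)
  qed
qed (fact assms)

theorem theorem3:
  fixes G :: "(real^'n^'n) set" and K\<^sub>0 :: "(real^'n) set"
  assumes "subgroup G GL" and "compact G"
    and "K\<^sub>0 \<in> convex_bodies"
  shows "(\<forall>x\<^sub>0 \<in> interior K\<^sub>0. x\<^sub>0 \<in> fixed_points (body_automorphisms (affine_group G) K\<^sub>0) \<longrightarrow>
           (\<exists>p. invariant_point_of_body (affine_group G) p \<and> p K\<^sub>0 = x\<^sub>0)) \<and>
         (\<forall>x\<^sub>0 \<in> fixed_points (body_automorphisms (affine_group G) K\<^sub>0).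
           \<exists>p. invariant_point (affine_group G) p \<and> p K\<^sub>0 = x\<^sub>0) \<and>
         (\<forall>K \<in> convex_bodies.
           fixed_points (body_automorphisms (affine_group G) K) =
             {p K |p. invariant_point (affine_group G) p})"
proof -
  interpret compact_matrix_group G by (rule compact_matrix_group_subgroup[OF assms(1,2)])
  show ?thesis
  proof (intro conjI ballI impI)
    show "\<exists>p. invariant_point_of_body (affine_group G) p \<and> p K\<^sub>0 = x"
      if "x \<in> interior K\<^sub>0" "x \<in> fixed_points (body_automorphisms (affine_group G) K\<^sub>0)" for x
      using invariant_point_of_body_exists[OF assms(1,3) _ that(2)] interior_subset that(1) by blast
    show "\<exists>p. invariant_point (affine_group G) p \<and> p K\<^sub>0 = x"
      if "x \<in> fixed_points (body_automorphisms (affine_group G) K\<^sub>0)" for x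
      by (rule invariant_point_exists[OF assms(1,3) that])
    show "fixed_points (body_automorphisms (affine_group G) K) =
        {p K |p. invariant_point (affine_group G) p}" if K: "K \<in> convex_bodies" for K
    proof (intro subset_antisym subsetI)
      show "x \<in> {p K |p. invariant_point (affine_group G) p}"
        if "x \<in> fixed_points (body_automorphisms (affine_group G) K)" for x
        using invariant_point_exists[OF assms(1) K that] by blast
      show "x \<in> fixed_points (body_automorphisms (affine_group G) K)"
        if "x \<in> {p K |p. invariant_point (affine_group G) p}" for x
        using that invariant_point_fixed K by blast
    qed
  qed
qed

end
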